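(* Let $T>0$, $L>0$, let $\mathring f\in C_c^2(\mathbb R^4)$ with $\mathring f\ge 0$, $\mathring E\in C_b^3(\mathbb R^2;\mathbb R^2)$, $\mathring B\in C_b^3(\mathbb R^2)$ with $\operatorname{div}\mathring E=\rho_{\mathring f}$, and let $U\in V$. Then the system (CVM) on $[0,T]$ has at most one solution $(f,E,B)$ with $f\in C^1([0,T]\times\mathbb R^4)$, $E\in C^2([0,T]\times\mathbb R^2;\mathbb R^2)$, $B\in C^2([0,T]\times\mathbb R^2)$; in particular, the solution of class $C_b^2$ which exists for these data is unique in this class.
   Context: Variables: $t\in[0,T]$, $x,p\in\mathbb R^2$; $f=f(t,x,p)\in\mathbb R$, $E=E(t,x)\in\mathbb R^2$, $B=B(t,x)\in\mathbb R$. Notation: $\widehat p=p/\sqrt{1+|p|^2}$; $a^\bot=(-a_2,a_1)$ for $a\in\mathbb R^2$; $\rho_f=4\pi\int_{\mathbb R^2} f\,dp$; $j_f=4\pi\int_{\mathbb R^2}\widehat p f\,dp$. The controlled relativistic Vlasov-Maxwell system (CVM) with initial data $(\mathring f,\mathring E,\mathring B)$ and control $U$ is $$\partial_t f+\widehat p\cdot\partial_x f+(E-\widehat p^\bot B)\cdot\partial_p f=0,$$ $$\partial_tE_1-\partial_{x_2}B=-j_{f,1}-U_1,\quad \partial_tE_2+\partial_{x_1}B=-j_{f,2}-U_2,\quad \partial_tB+\partial_{x_1}E_2-\partial_{x_2}E_1=0,$$ $$\operatorname{div}_xE=\rho_f-\int_0^t\operatorname{div}_xU\,d\tau,\quad (f,E,B)|_{t=0}=(\mathring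 f,\mathring E,\mathring B).$$ Control space: $V=\{d\in W^{2,1}(0,T;C_b^4(\mathbb R^2;\mathbb R^2)) : d(t,x)=0\text{ for }|x|\ge L\}$, with the $W^{2,1}(0,T;C_b^4)$-norm. $C_b^k$ is the space of $k$ times continuously differentiable functions with all derivatives up to order $k$ bounded; index $c$ means compactly supported. *)

theory Defs
  imports "HOL-Analysis.Analysis"
begin

section \<open>The classes $C^k$ and $C^k_b$\<close>

text \<open>
  Derivatives are taken within \<open>S\<close>, so that they are one-sided on the boundary. The notions below
  are meaningful for sets on which the derivative within \<open>S\<close> is unique at every point, such as
  the whole space, a nondegenerate interval, or \<open>[0,T] \<times> \<real>\<^sup>n\<close>.
\<close>

definition pd :: "'a::euclidean_space set \<Rightarrow> 'a \<Rightarrow> ('a \<Rightarrow> 'b::real_normed_vector) \<Rightarrow> 'a \<Rightarrow> 'b" where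
  "pd S b f x = frechet_derivative f (at x within S) b"

fun Ck_on :: "nat \<Rightarrow> 'a::euclidean_space set \<Rightarrow> ('a \<Rightarrow> 'b::real_normed_vector) \<Rightarrow> bool" where
  "Ck_on 0 S f \<longleftrightarrow> continuous_on S f"
| "Ck_on (Suc k) S f \<longleftrightarrow> f differentiable_on S \<and> (\<forall>b\<in>Basis. Ck_on k S (pd S b f))"

definition multi_indices :: "nat \<Rightarrow> 'a::euclidean_space list set" where
  "multi_indices k = {bs. set bs \<subseteq> Basis \<and> length bs \<le> k}"

text \<open>\<open>fold (pd S) [b\<^sub>1, \<dots>, b\<^sub>m] f\<close> is the iterated partial derivative
  \<open>\<partial>\<^bsub>b\<^sub>m\<^esub> \<dots> \<partial>\<^bsub>b\<^sub>1\<^esub> f\<close>.\<close>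

definition Cbk_on :: "nat \<Rightarrow> 'a::euclidean_space set \<Rightarrow> ('a \<Rightarrow> 'b::real_normed_vector) \<Rightarrow> bool" where
  "Cbk_on k S f \<longleftrightarrow> Ck_on k S f \<and> (\<forall>bs\<in>multi_indices k. bounded (fold (pd S) bs f ` S))"

definition Cck :: "nat \<Rightarrow> ('a::euclidean_space \<Rightarrow> 'b::real_normed_vector) \<Rightarrow> bool" where
  "Cck k f \<longleftrightarrow> Ck_on k UNIV f \<and> compact (closure {x. f x \<noteq> 0})"

lemma pd_lincomb:
  assumes "f differentiable_on UNIV" "g differentiable_on UNIV"
  shows "pd UNIV b (\<lambda>x. r *\<^sub>R f x + s *\<^sub>R g x) = (\<lambda>x. r *\<^sub>R pd UNIV b f x + s *\<^sub>R pd UNIV b g x)"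
proof
  fix x
  have "(f has_derivative frechet_derivative f (at x)) (at x)"
    "(g has_derivative frechet_derivative g (at x)) (at x)"
    using assms by (auto simp: differentiable_on_def frechet_derivative_works)
  then have "((\<lambda>x. r *\<^sub>R f x + s *\<^sub>R g x) has_derivative
      (\<lambda>h. r *\<^sub>R frechet_derivative f (at x) h + s *\<^sub>R frechet_derivative g (at x) h)) (at x)"
    by (auto intro!: derivative_intros)
  from frechet_derivative_at[OF this]
  show "pd UNIV b (\<lambda>x. r *\<^sub>R f x + s *\<^sub>R g x) x = r *\<^sub>R pd UNIV b f x + s *\<^sub>R pd UNIV b g x"
    unfolding pd_def by metis
qed

lemma Ck_on_lincomb:
  "Ck_on k UNIV f \<Longrightarrow> Ck_on k UNIV g \<Longrightarrow> Ck_on k UNIV (\<lambda>x. r *\<^sub>R f x + s *\<^sub>R g x)"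
proof (induction k arbitrary: f g)
  case 0
  then show ?case by (auto intro!: continuous_intros)
next
  case (Suc k)
  then show ?case
    by (auto simp: pd_lincomb differentiable_on_def intro!: differentiable_add differentiable_scaleR)
qed

lemma fold_pd_lincomb:
  "Ck_on k UNIV f \<Longrightarrow> Ck_on k UNIV g \<Longrightarrow> bs \<in> multi_indices k \<Longrightarrow>
    fold (pd UNIV) bs (\<lambda>x. r *\<^sub>R f x + s *\<^sub>R g x) =
    (\<lambda>x. r *\<^sub>R fold (pd UNIV) bs f x + s *\<^sub>R fold (pd UNIV) bs g x)"
proof (induction bs arbitrary: f g k)
  case Nil
  then show ?case by simp
next
  case (Cons b bs)
  from Cons.prems obtain m where m: "k = Suc m" "b \<in> Basis" "bs \<in> multi_indices m"
    by (cases k) (auto simp: multi_indices_def)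
  show ?case
    using Cons.prems Cons.IH[of m "pd UNIV b f" "pd UNIV b g"] m by (simp add: pd_lincomb)
qed

lemma Cbk_on_lincomb:
  assumes "Cbk_on k UNIV f" "Cbk_on k UNIV g"
  shows "Cbk_on k UNIV (\<lambda>x. r *\<^sub>R f x + s *\<^sub>R g x)"
  using assms unfolding Cbk_on_def
  by (auto simp: Ck_on_lincomb fold_pd_lincomb intro!: bounded_plus_comp bounded_scaleR_comp)

lemma Cbk_on_zero: "Cbk_on k UNIV (\<lambda>x. 0)"
proof -
  have pd0: "pd UNIV b (\<lambda>x::'a. 0::'b) = (\<lambda>x. 0)" for b
    by (auto simp: pd_def)
  have "Ck_on k UNIV (\<lambda>x::'a. 0::'b)"
    by (induction k) (auto simp: pd0)
  moreover have "fold (pd UNIV) bs (\<lambda>x::'a. 0::'b) = (\<lambda>x. 0)" for bs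
    by (induction bs) (auto simp: pd0)
  ultimately show ?thesis
    by (auto simp: Cbk_on_def image_constant_conv)
qed

section \<open>The normed space $C^4_b$\<close>

typedef (overloaded) ('a, 'b) Cb4 = "{f :: 'a::euclidean_space \<Rightarrow> 'b::real_normed_vector. Cbk_on 4 UNIV f}"
  morphisms apply_Cb4 Cb4
  by (auto intro: Cbk_on_zero)

setup_lifting type_definition_Cb4

lemma Cb4_eqI: "(\<And>x. apply_Cb4 f x = apply_Cb4 g x) \<Longrightarrow> f = g"
  by transfer auto

instantiation Cb4 :: (euclidean_space, real_normed_vector) real_vector
begin

lift_definition zero_Cb4 :: "('a, 'b) Cb4" is "\<lambda>x. 0"
  by (rule Cbk_on_zero)

lift_definition plus_Cb4 :: "('a, 'b) Cb4 \<Rightarrow> ('a, 'b) Cb4 \<Rightarrow> ('a, 'b) Cb4" is "\<lambda>f g x. f x + g x"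
  using Cbk_on_lincomb[where r = 1 and s = 1] by auto

lift_definition minus_Cb4 :: "('a, 'b) Cb4 \<Rightarrow> ('a, 'b) Cb4 \<Rightarrow> ('a, 'b) Cb4" is "\<lambda>f g x. f x - g x"
  using Cbk_on_lincomb[where r = 1 and s = "-1"] by auto

lift_definition uminus_Cb4 :: "('a, 'b) Cb4 \<Rightarrow> ('a, 'b) Cb4" is "\<lambda>f x. - f x"
  using Cbk_on_lincomb[where r = "-1" and s = 0] by fastforce

lift_definition scaleR_Cb4 :: "real \<Rightarrow> ('a, 'b) Cb4 \<Rightarrow> ('a, 'b) Cb4" is "\<lambda>r f x. r *\<^sub>R f x"
  using Cbk_on_lincomb[where s = 0] by fastforce

instance
  by standard (transfer; auto simp: algebra_simps)+

end

lemma finite_multi_indices: "finite (multi_indices k :: 'a::euclidean_space list set)"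
  using finite_lists_length_le[of "Basis :: 'a set" k] by (simp add: multi_indices_def)

lemma Nil_multi_indices: "[] \<in> multi_indices k"
  by (simp add: multi_indices_def)

lemma Cbk_on_bdd_above:
  fixes f :: "'a::euclidean_space \<Rightarrow> 'b::real_normed_vector"
  assumes "Cbk_on k UNIV f"
  shows "bdd_above ((\<lambda>(bs, x). norm (fold (pd UNIV) bs f x)) ` (multi_indices k \<times> UNIV))"
proof -
  have "bounded (\<Union>bs\<in>multi_indices k. range (fold (pd UNIV) bs f))"
    using assms finite_multi_indices by (auto simp: Cbk_on_def intro!: bounded_UN)
  then obtain c where "\<And>bs x. bs \<in> multi_indices k \<Longrightarrow> norm (fold (pd UNIV) bs f x) \<le> c"
    unfolding bounded_iff by blast
  then show ?thesis by (auto intro!: bdd_aboveI[of _ c])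
qed

instantiation Cb4 :: (euclidean_space, real_normed_vector) real_normed_vector
begin

lift_definition norm_Cb4 :: "('a, 'b) Cb4 \<Rightarrow> real" is
  "\<lambda>f. SUP (bs, x) \<in> multi_indices 4 \<times> UNIV. norm (fold (pd UNIV) bs f x)" .

definition dist_Cb4 :: "('a, 'b) Cb4 \<Rightarrow> ('a, 'b) Cb4 \<Rightarrow> real" where
  "dist_Cb4 f g = norm (f - g)"

definition uniformity_Cb4 :: "(('a, 'b) Cb4 \<times> ('a, 'b) Cb4) filter" where
  "uniformity_Cb4 = (INF e\<in>{0 <..}. principal {(x, y). dist x y < e})"

definition open_Cb4 :: "('a, 'b) Cb4 set \<Rightarrow> bool" where
  "open_Cb4 S = (\<forall>x\<in>S. \<forall>\<^sub>F (x', y) in uniformity. x' = x \<longrightarrow> y \<in> S)"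

definition sgn_Cb4 :: "('a, 'b) Cb4 \<Rightarrow> ('a, 'b) Cb4" where
  "sgn_Cb4 f = f /\<^sub>R norm f"

lemma fold_pd_le_norm_Cb4:
  "bs \<in> multi_indices 4 \<Longrightarrow> norm (fold (pd UNIV) bs (apply_Cb4 f) x) \<le> norm f"
proof transfer
  fix bs :: "'a list" and f :: "'a \<Rightarrow> 'b" and x
  assume "bs \<in> multi_indices 4" "Cbk_on 4 UNIV f"
  then show "norm (fold (pd UNIV) bs f x) \<le>
      (SUP (bs, x) \<in> multi_indices 4 \<times> UNIV. norm (fold (pd UNIV) bs f x))"
    using cSUP_upper[OF _ Cbk_on_bdd_above[of 4 f], of "(bs, x)"] by simp
qed

lemma norm_Cb4_le:
  assumes "\<And>bs x. bs \<in> multi_indices 4 \<Longrightarrow> norm (fold (pd UNIV) bs (apply_Cb4 f) x) \<le> c"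
  shows "norm f \<le> c"
  unfolding norm_Cb4.rep_eq using Nil_multi_indices assms by (intro cSUP_least) auto

lemma norm_Cb4_scaleR_le: "norm (a *\<^sub>R f) \<le> \<bar>a\<bar> * norm (f :: ('a, 'b) Cb4)"
proof (rule norm_Cb4_le)
  fix bs :: "'a list" and x
  assume bs: "bs \<in> multi_indices 4"
  have "Ck_on 4 UNIV (apply_Cb4 f)" using apply_Cb4[of f] by (simp add: Cbk_on_def)
  from fold_pd_lincomb[OF this this bs, of a 0]
  have "fold (pd UNIV) bs (apply_Cb4 (a *\<^sub>R f)) x = a *\<^sub>R fold (pd UNIV) bs (apply_Cb4 f) x"
    by (simp add: scaleR_Cb4.rep_eq)
  then show "norm (fold (pd UNIV) bs (apply_Cb4 (a *\<^sub>R f)) x) \<le> \<bar>a\<bar> * norm f"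
    using fold_pd_le_norm_Cb4[OF bs, of f x] by (simp add: mult_left_mono)
qed

instance
proof
  fix f g :: "('a, 'b) Cb4" and a :: real
  show "dist f g = norm (f - g)" by (rule dist_Cb4_def)
  show "sgn f = f /\<^sub>R norm f" by (rule sgn_Cb4_def)
  show "uniformity = (INF e\<in>{0 <..}. principal {(x, y :: ('a, 'b) Cb4). dist x y < e})"
    by (rule uniformity_Cb4_def)
  show "open S = (\<forall>x\<in>S. \<forall>\<^sub>F (x', y) in uniformity. x' = x \<longrightarrow> y \<in> S)" for S :: "('a, 'b) Cb4 set"
    by (rule open_Cb4_def)
  have zero: "norm (0 :: ('a, 'b) Cb4) \<le> 0"
    using norm_Cb4_scaleR_le[of 0 "0 :: ('a, 'b) Cb4"] by simp
  have nonneg: "0 \<le> norm h" for h :: "('a, 'b) Cb4"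
    using fold_pd_le_norm_Cb4[OF Nil_multi_indices, of h] norm_ge_zero order_trans by blast
  show "norm f = 0 \<longleftrightarrow> f = 0"
  proof
    assume "norm f = 0"
    then have "apply_Cb4 f x = 0" for x
      using fold_pd_le_norm_Cb4[OF Nil_multi_indices, of f x] by simp
    then show "f = 0" by (intro Cb4_eqI) (simp add: zero_Cb4.rep_eq)
  next
    assume "f = 0"
    then show "norm f = 0" using zero nonneg[of f] by simp
  qed
  show "norm (f + g) \<le> norm f + norm g"
  proof (rule norm_Cb4_le)
    fix bs :: "'a list" and x
    assume bs: "bs \<in> multi_indices 4"
    have "Ck_on 4 UNIV (apply_Cb4 f)" "Ck_on 4 UNIV (apply_Cb4 g)"
      using apply_Cb4[of f] apply_Cb4[of g] by (simp_all add: Cbk_on_def)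
    from fold_pd_lincomb[OF this bs, of 1 1]
    have "fold (pd UNIV) bs (apply_Cb4 (f + g)) x =
        fold (pd UNIV) bs (apply_Cb4 f) x + fold (pd UNIV) bs (apply_Cb4 g) x"
      by (simp add: plus_Cb4.rep_eq)
    then show "norm (fold (pd UNIV) bs (apply_Cb4 (f + g)) x) \<le> norm f + norm g"
      using fold_pd_le_norm_Cb4[OF bs, of f x] fold_pd_le_norm_Cb4[OF bs, of g x]
      by (simp add: norm_triangle_le)
  qed
  show "norm (a *\<^sub>R f) = \<bar>a\<bar> * norm f"
  proof (cases "a = 0")
    case True
    then show ?thesis using zero nonneg[of "0 :: ('a, 'b) Cb4"] by simp
  next
    case False
    have "norm f = norm (inverse a *\<^sub>R (a *\<^sub>R f))" using False by simp
    also have "\<dots> \<le> \<bar>inverse a\<bar> * norm (a *\<^sub>R f)" by (rule norm_Cb4_scaleR_le)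
    finally have "\<bar>a\<bar> * norm f \<le> norm (a *\<^sub>R f)" using False by (simp add: field_simps)
    then show ?thesis using norm_Cb4_scaleR_le[of a f] by simp
  qed
qed

end

section \<open>Vector-valued Sobolev functions\<close>

text \<open>
  The Bochner integral of \<^theory>\<open>HOL-Analysis.Bochner_Integration\<close> requires a second countable
  target space, which \<open>C\<^sup>4\<^sub>b\<close> is not. Strong measurability is therefore required
  explicitly here, in place of Borel measurability.
\<close>

definition strongly_measurable :: "'a measure \<Rightarrow> ('a \<Rightarrow> 'b::real_normed_vector) \<Rightarrow> bool" where
  "strongly_measurable M f \<longleftrightarrow>
    (\<exists>s. (\<forall>i. simple_function M (s i)) \<and> (AE t in M. (\<lambda>i::nat. s i t) \<longlonglongrightarrow> f t))"

definition has_strong_integral ::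
    "'a measure \<Rightarrow> ('a \<Rightarrow> 'b::real_normed_vector) \<Rightarrow> 'b \<Rightarrow> bool" where
  "has_strong_integral M f v \<longleftrightarrow> strongly_measurable M f \<and>
    (\<exists>s. (\<forall>i. Bochner_Integration.simple_bochner_integrable M (s i)) \<and>
      (\<lambda>i::nat. \<integral>\<^sup>+ t. norm (f t - s i t) \<partial>M) \<longlonglongrightarrow> 0 \<and>
      (\<lambda>i. Bochner_Integration.simple_bochner_integral M (s i)) \<longlonglongrightarrow> v)"

definition L1_time :: "real \<Rightarrow> (real \<Rightarrow> 'b::real_normed_vector) \<Rightarrow> bool" where
  "L1_time T g \<longleftrightarrow> strongly_measurable (lebesgue_on {0<..<T}) g \<and>
    (\<integral>\<^sup>+ t. norm (g t) \<partial>lebesgue_on {0<..<T}) < \<infinity>"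

definition test_function :: "real \<Rightarrow> (real \<Rightarrow> real) \<Rightarrow> bool" where
  "test_function T \<phi> \<longleftrightarrow> (\<forall>k. Cck k \<phi>) \<and> closure {t. \<phi> t \<noteq> 0} \<subseteq> {0<..<T}"

definition weak_deriv :: "real \<Rightarrow> (real \<Rightarrow> 'b::real_normed_vector) \<Rightarrow> (real \<Rightarrow> 'b) \<Rightarrow> bool" where
  "weak_deriv T g h \<longleftrightarrow> (\<forall>\<phi>. test_function T \<phi> \<longrightarrow>
    (\<exists>v. has_strong_integral (lebesgue_on {0<..<T}) (\<lambda>t. deriv \<phi> t *\<^sub>R g t) v \<and>
         has_strong_integral (lebesgue_on {0<..<T}) (\<lambda>t. \<phi> t *\<^sub>R h t) (- v)))"

definition W21 :: "real \<Rightarrow> (real \<Rightarrow> 'b::real_normed_vector) set" where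
  "W21 T = {d. L1_time T d \<and>
    (\<exists>d1 d2. L1_time T d1 \<and> L1_time T d2 \<and> weak_deriv T d d1 \<and> weak_deriv T d1 d2)}"

text \<open>
  An element of \<open>W\<^sup>2\<^sup>,\<^sup>1(0,T;X)\<close> is a class of functions modulo null sets. It is represented
  by its unique continuous representative on \<open>[0,T]\<close>, which is the one that is evaluated
  pointwise in the field equations.
\<close>

definition control_space :: "real \<Rightarrow> real \<Rightarrow> (real \<Rightarrow> (real^2, real^2) Cb4) set" where
  "control_space T L = {d \<in> W21 T. continuous_on {0..T} d \<and>
    (\<forall>t\<in>{0..T}. \<forall>x. norm x \<ge> L \<longrightarrow> apply_Cb4 (d t) x = 0)}"

section \<open>The controlled relativistic Vlasov--Maxwell system\<close>

definition hat :: "real^2 \<Rightarrow> real^2" where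
  "hat p = p /\<^sub>R sqrt (1 + (norm p)\<^sup>2)"

definition perp :: "real^2 \<Rightarrow> real^2" where
  "perp a = vector [- a $ 2, a $ 1]"

definition charge_density :: "((real^2) \<times> (real^2) \<Rightarrow> real) \<Rightarrow> real^2 \<Rightarrow> real" where
  "charge_density g x = 4 * pi * (LINT p|lborel. g (x, p))"

definition current_density :: "((real^2) \<times> (real^2) \<Rightarrow> real) \<Rightarrow> real^2 \<Rightarrow> real^2" where
  "current_density g x = (4 * pi) *\<^sub>R (LINT p|lborel. g (x, p) *\<^sub>R hat p)"

definition partial :: "2 \<Rightarrow> (real^2 \<Rightarrow> 'b::real_normed_vector) \<Rightarrow> real^2 \<Rightarrow> 'b" where
  "partial i g x = pd UNIV (axis i 1) g x"

definition divergence :: "(real^2 \<Rightarrow> real^2) \<Rightarrow> real^2 \<Rightarrow> real" where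
  "divergence F x = partial 1 (\<lambda>y. F y $ 1) x + partial 2 (\<lambda>y. F y $ 2) x"

abbreviation time_deriv :: "real \<Rightarrow> (real \<Rightarrow> 'b::real_normed_vector) \<Rightarrow> real \<Rightarrow> 'b" where
  "time_deriv T g t \<equiv> pd {0..T} 1 g t"

definition vlasov_eq ::
    "real \<Rightarrow> (real \<times> (real^2) \<times> (real^2) \<Rightarrow> real) \<Rightarrow> (real \<times> (real^2) \<Rightarrow> real^2) \<Rightarrow>
      (real \<times> (real^2) \<Rightarrow> real) \<Rightarrow> bool" where
  "vlasov_eq T f E B \<longleftrightarrow> (\<forall>t\<in>{0..T}. \<forall>x p.
    time_deriv T (\<lambda>s. f (s, x, p)) t
    + (\<Sum>i\<in>UNIV. hat p $ i * partial i (\<lambda>y. f (t, y, p)) x)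
    + (\<Sum>i\<in>UNIV. (E (t, x) - B (t, x) *\<^sub>R perp (hat p)) $ i * partial i (\<lambda>q. f (t, x, q)) p) = 0)"

text \<open>The first conjunct states that the integrals defining \<open>\<rho>\<^sub>f\<close> (and hence \<open>j\<^sub>f\<close>, as \<open>hat\<close> is
  bounded) exist.\<close>

definition maxwell_eqs ::
    "real \<Rightarrow> (real \<Rightarrow> (real^2, real^2) Cb4) \<Rightarrow> (real \<times> (real^2) \<times> (real^2) \<Rightarrow> real) \<Rightarrow>
      (real \<times> (real^2) \<Rightarrow> real^2) \<Rightarrow> (real \<times> (real^2) \<Rightarrow> real) \<Rightarrow> bool" where
  "maxwell_eqs T U f E B \<longleftrightarrow> (\<forall>t\<in>{0..T}. \<forall>x.
    integrable lborel (\<lambda>p. f (t, x, p)) \<and>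
    time_deriv T (\<lambda>s. E (s, x) $ 1) t - partial 2 (\<lambda>y. B (t, y)) x
      = - current_density (\<lambda>z. f (t, z)) x $ 1 - apply_Cb4 (U t) x $ 1 \<and>
    time_deriv T (\<lambda>s. E (s, x) $ 2) t + partial 1 (\<lambda>y. B (t, y)) x
      = - current_density (\<lambda>z. f (t, z)) x $ 2 - apply_Cb4 (U t) x $ 2 \<and>
    time_deriv T (\<lambda>s. B (s, x)) t + partial 1 (\<lambda>y. E (t, y) $ 2) x - partial 2 (\<lambda>y. E (t, y) $ 1) x
      = 0 \<and>
    divergence (\<lambda>y. E (t, y)) x
      = charge_density (\<lambda>z. f (t, z)) x - integral {0..t} (\<lambda>\<tau>. divergence (apply_Cb4 (U \<tau>)) x))"

definition CVM ::
    "real \<Rightarrow> (real \<Rightarrow> (real^2, real^2) Cb4) \<Rightarrow>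
      ((real^2) \<times> (real^2) \<Rightarrow> real) \<Rightarrow> (real^2 \<Rightarrow> real^2) \<Rightarrow> (real^2 \<Rightarrow> real) \<Rightarrow>
      (real \<times> (real^2) \<times> (real^2) \<Rightarrow> real) \<Rightarrow>
      (real \<times> (real^2) \<Rightarrow> real^2) \<Rightarrow> (real \<times> (real^2) \<Rightarrow> real) \<Rightarrow> bool" where
  "CVM T U f0 E0 B0 f E B \<longleftrightarrow>
    vlasov_eq T f E B \<and> maxwell_eqs T U f E B \<and>
    (\<forall>x p. f (0, x, p) = f0 (x, p)) \<and> (\<forall>x. E (0, x) = E0 x) \<and> (\<forall>x. B (0, x) = B0 x)"

definition classical_solution ::
    "real \<Rightarrow> (real \<Rightarrow> (real^2, real^2) Cb4) \<Rightarrow>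
      ((real^2) \<times> (real^2) \<Rightarrow> real) \<Rightarrow> (real^2 \<Rightarrow> real^2) \<Rightarrow> (real^2 \<Rightarrow> real) \<Rightarrow>
      (real \<times> (real^2) \<times> (real^2) \<Rightarrow> real) \<Rightarrow>
      (real \<times> (real^2) \<Rightarrow> real^2) \<Rightarrow> (real \<times> (real^2) \<Rightarrow> real) \<Rightarrow> bool" where
  "classical_solution T U f0 E0 B0 f E B \<longleftrightarrow>
    Ck_on 1 ({0..T} \<times> UNIV) f \<and> Ck_on 2 ({0..T} \<times> UNIV) E \<and> Ck_on 2 ({0..T} \<times> UNIV) B \<and>
    CVM T U f0 E0 B0 f E B"

definition Cb2_solution ::
    "real \<Rightarrow> (real \<Rightarrow> (real^2, real^2) Cb4) \<Rightarrow>
      ((real^2) \<times> (real^2) \<Rightarrow> real) \<Rightarrow> (real^2 \<Rightarrow> real^2) \<Rightarrow> (real^2 \<Rightarrow> real) \<Rightarrow>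
      (real \<times> (real^2) \<times> (real^2) \<Rightarrow> real) \<Rightarrow>
      (real \<times> (real^2) \<Rightarrow> real^2) \<Rightarrow> (real \<times> (real^2) \<Rightarrow> real) \<Rightarrow> bool" where
  "Cb2_solution T U f0 E0 B0 f E B \<longleftrightarrow>
    Cbk_on 2 ({0..T} \<times> UNIV) f \<and> Cbk_on 2 ({0..T} \<times> UNIV) E \<and> Cbk_on 2 ({0..T} \<times> UNIV) B \<and>
    CVM T U f0 E0 B0 f E B"

definition same_on ::
    "real \<Rightarrow> (real \<times> (real^2) \<times> (real^2) \<Rightarrow> real) \<Rightarrow>
      (real \<times> (real^2) \<Rightarrow> real^2) \<Rightarrow> (real \<times> (real^2) \<Rightarrow> real) \<Rightarrow>
      (real \<times> (real^2) \<times> (real^2) \<Rightarrow> real) \<Rightarrow>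
      (real \<times> (real^2) \<Rightarrow> real^2) \<Rightarrow> (real \<times> (real^2) \<Rightarrow> real) \<Rightarrow> bool" where
  "same_on T f E B f' E' B' \<longleftrightarrow> (\<forall>t\<in>{0..T}. \<forall>x.
    (\<forall>p. f (t, x, p) = f' (t, x, p)) \<and> E (t, x) = E' (t, x) \<and> B (t, x) = B' (t, x))"

end

theory Submission
  imports Defs
begin

text \<open>
  The difference \<open>(g, D, b)\<close> of two solutions is estimated in a weighted \<open>L\<^sup>2\<close> norm. The weight
  \<open>w(t,x) = max(0, R - t - \<langle>x\<rangle>)\<^sup>2\<close>, with \<open>\<langle>x\<rangle>\<close> the square root of \<open>1 + |x|\<^sup>2\<close>, is supported in a
  backward cone and decreases along every velocity of modulus at most \<open>1\<close>, so the fields, which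
  may grow in \<open>x\<close>, only enter through their values on a compact set. There the force is bounded by
  some \<open>M\<close>, so momenta grow by at most \<open>M T\<close>, and a maximum principle for the transport equation
  replaces the characteristics in showing that \<open>f\<close> has compact momentum support inside the cone.
  Hence the current of \<open>g\<close> is controlled by \<open>\<integral> g\<^sup>2 dp\<close> and \<open>\<partial>\<^sub>p f'\<close> is bounded where it matters.
  With \<open>Y\<^sub>1\<close> the integral of \<open>w (|D|\<^sup>2 + b\<^sup>2)\<close> and \<open>Y\<^sub>2\<close> that of \<open>w g\<^sup>2\<close>, the energy identities
  yield \<open>(Y\<^sub>1 + Y\<^sub>2)' \<le> C (Y\<^sub>1 + Y\<^sub>2)\<close>, and the difference vanishes by Gronwall's inequality.
\<close>

section \<open>Continuously differentiable functions\<close>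

lemma Ck_on_Suc_imp: "Ck_on (Suc k) S u \<Longrightarrow> Ck_on k S u"
proof (induction k arbitrary: u)
  case 0
  then show ?case by (simp add: differentiable_imp_continuous_on)
next
  case (Suc k)
  then show ?case by (metis Ck_on.simps(2))
qed

lemmas Ck_on_2_imp_1 = Ck_on_Suc_imp[of 1, unfolded Suc_1]

text \<open>The total derivative is carried as an explicit function, so that product and chain rules
  produce formulas that can be evaluated in the energy identities. Continuity is asked direction by
  direction; in finite dimension this is continuity of the derivative.\<close>

definition C1_deriv ::
    "'a::real_normed_vector set \<Rightarrow> ('a \<Rightarrow> 'b::real_normed_vector) \<Rightarrow> ('a \<Rightarrow> 'a \<Rightarrow> 'b) \<Rightarrow> bool" where
  "C1_deriv S u Du \<longleftrightarrow> (\<forall>z\<in>S. (u has_derivative Du z) (at z within S)) \<and>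
    (\<forall>h. continuous_on S (\<lambda>z. Du z h))"

lemma C1_derivD:
  assumes "C1_deriv S u Du"
  shows "z \<in> S \<Longrightarrow> (u has_derivative Du z) (at z within S)"
    and "continuous_on S (\<lambda>z. Du z h)"
    and "continuous_on S u"
proof -
  show D: "z \<in> S \<Longrightarrow> (u has_derivative Du z) (at z within S)" for z
    using assms by (simp add: C1_deriv_def)
  show "continuous_on S (\<lambda>z. Du z h)"
    using assms by (simp add: C1_deriv_def)
  show "continuous_on S u"
    by (rule has_derivative_continuous_on[OF D])
qed

lemma linear_componentwise_expansion:
  fixes A :: "'a::euclidean_space \<Rightarrow> 'b::real_vector"
  assumes "linear A"
  shows "A h = (\<Sum>b\<in>Basis. (h \<bullet> b) *\<^sub>R A b)"
proof -
  have "A h = A (\<Sum>b\<in>Basis. (h \<bullet> b) *\<^sub>R b)" by (simp add: euclidean_representation)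
  then show ?thesis by (simp add: linear_sum[OF assms] linear_scale[OF assms])
qed

text \<open>Continuity is given for the partial derivatives along \<open>Basis\<close> only;
  expanding an arbitrary direction in the basis yields the rest.\<close>

lemma Ck_on_1_imp_C1_deriv:
  fixes u :: "'a::euclidean_space \<Rightarrow> 'b::real_normed_vector"
  assumes "Ck_on 1 S u"
  shows "C1_deriv S u (\<lambda>z. frechet_derivative u (at z within S))"
  unfolding C1_deriv_def
proof (intro conjI ballI allI)
  have diff: "u differentiable_on S" and cont: "\<And>b. b \<in> Basis \<Longrightarrow> continuous_on S (pd S b u)"
    using assms by (auto simp: One_nat_def)
  show D: "(u has_derivative frechet_derivative u (at z within S)) (at z within S)" if "z \<in> S" for z
    using diff that by (auto simp: differentiable_on_def frechet_derivative_works)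
  fix h
  have "continuous_on S (\<lambda>z. \<Sum>b\<in>Basis. (h \<bullet> b) *\<^sub>R pd S b u z)"
    by (intro continuous_intros cont)
  moreover have "(\<Sum>b\<in>Basis. (h \<bullet> b) *\<^sub>R pd S b u z) = frechet_derivative u (at z within S) h"
    if "z \<in> S" for z
    unfolding pd_def
    by (rule sym, rule linear_componentwise_expansion, rule has_derivative_linear[OF D[OF that]])
  ultimately show "continuous_on S (\<lambda>z. frechet_derivative u (at z within S) h)"
    by (rule continuous_on_eq) auto
qed

section \<open>Product and chain rules\<close>

lemma C1_deriv_const: "C1_deriv S (\<lambda>z. c) (\<lambda>z h. 0)"
  by (auto simp: C1_deriv_def)

lemma C1_deriv_linear: "bounded_linear u \<Longrightarrow> C1_deriv S u (\<lambda>z. u)"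
  by (auto simp: C1_deriv_def bounded_linear_imp_has_derivative)

lemma C1_deriv_diff:
  assumes "C1_deriv S u Du" "C1_deriv S v Dv"
  shows "C1_deriv S (\<lambda>z. u z - v z) (\<lambda>z h. Du z h - Dv z h)"
  using has_derivative_diff[OF C1_derivD(1)[OF assms(1)] C1_derivD(1)[OF assms(2)]]
    continuous_on_diff[OF C1_derivD(2)[OF assms(1)] C1_derivD(2)[OF assms(2)]]
  unfolding C1_deriv_def by blast

lemma C1_deriv_add:
  assumes "C1_deriv S u Du" "C1_deriv S v Dv"
  shows "C1_deriv S (\<lambda>z. u z + v z) (\<lambda>z h. Du z h + Dv z h)"
  using has_derivative_add[OF C1_derivD(1)[OF assms(1)] C1_derivD(1)[OF assms(2)]]
    continuous_on_add[OF C1_derivD(2)[OF assms(1)] C1_derivD(2)[OF assms(2)]]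
  unfolding C1_deriv_def by blast

lemma C1_deriv_Pair:
  assumes "C1_deriv S u Du" "C1_deriv S v Dv"
  shows "C1_deriv S (\<lambda>z. (u z, v z)) (\<lambda>z h. (Du z h, Dv z h))"
  using has_derivative_Pair[OF C1_derivD(1)[OF assms(1)] C1_derivD(1)[OF assms(2)]]
    continuous_on_Pair[OF C1_derivD(2)[OF assms(1)] C1_derivD(2)[OF assms(2)]]
  unfolding C1_deriv_def by blast

lemma C1_deriv_bilinear:
  assumes B: "bounded_bilinear pr" and "C1_deriv S u Du" "C1_deriv S v Dv"
  shows "C1_deriv S (\<lambda>z. pr (u z) (v z)) (\<lambda>z h. pr (u z) (Dv z h) + pr (Du z h) (v z))"
  unfolding C1_deriv_def
proof (intro conjI ballI allI)
  show "((\<lambda>z. pr (u z) (v z)) has_derivative (\<lambda>h. pr (u z) (Dv z h) + pr (Du z h) (v z))) (at z within S)"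
    if "z \<in> S" for z
    by (rule bounded_bilinear.FDERIV[OF B C1_derivD(1)[OF assms(2) that] C1_derivD(1)[OF assms(3) that]])
  show "continuous_on S (\<lambda>z. pr (u z) (Dv z h) + pr (Du z h) (v z))" for h
    using C1_derivD(2,3)[OF assms(2)] C1_derivD(2,3)[OF assms(3)]
    by (intro continuous_on_add bounded_bilinear.continuous_on[OF B])
qed

lemmas C1_deriv_mult = C1_deriv_bilinear[OF bounded_bilinear_mult]
lemmas C1_deriv_scaleR = C1_deriv_bilinear[OF bounded_bilinear_scaleR]
lemmas C1_deriv_inner = C1_deriv_bilinear[OF bounded_bilinear_inner]

lemma C1_deriv_compose:
  fixes u :: "'a::real_normed_vector \<Rightarrow> 'b::euclidean_space"
  assumes u: "C1_deriv S u Du" and G: "C1_deriv R G DG" and sub: "u ` S \<subseteq> R"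
  shows "C1_deriv S (\<lambda>z. G (u z)) (\<lambda>z h. DG (u z) (Du z h))"
  unfolding C1_deriv_def
proof (intro conjI ballI allI)
  show "((\<lambda>z. G (u z)) has_derivative (\<lambda>h. DG (u z) (Du z h))) (at z within S)" if "z \<in> S" for z
  proof (rule has_derivative_in_compose[where f = u and f' = "Du z" and g = G and g' = "DG (u z)"])
    show "(u has_derivative Du z) (at z within S)"
      by (rule C1_derivD(1)[OF u that])
    show "(G has_derivative DG (u z)) (at (u z) within u ` S)"
      using that sub by (intro has_derivative_subset[OF C1_derivD(1)[OF G] sub]) auto
  qed
  fix h
  \<comment> \<open>The direction \<open>Du z h\<close> moves with z, while continuity of
    \<open>DG\<close> is known for fixed directions only, so the direction is expanded in the
    basis.\<close>
  have "continuous_on S (\<lambda>z. \<Sum>b\<in>Basis. (Du z h \<bullet> b) *\<^sub>R DG (u z) b)"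
    by (intro continuous_on_sum continuous_on_scaleR continuous_on_inner continuous_on_const
        C1_derivD(2)[OF u] continuous_on_compose2[OF C1_derivD(2)[OF G] C1_derivD(3)[OF u] sub])
  moreover have "(\<Sum>b\<in>Basis. (Du z h \<bullet> b) *\<^sub>R DG (u z) b) = DG (u z) (Du z h)" if "z \<in> S" for z
    using that sub
    by (intro sym[OF linear_componentwise_expansion] has_derivative_linear[OF C1_derivD(1)[OF G]]) auto
  ultimately show "continuous_on S (\<lambda>z. DG (u z) (Du z h))"
    by (rule continuous_on_eq) auto
qed

section \<open>Time and space slices\<close>

lemma C1_deriv_time_slice:
  assumes "C1_deriv ({0..T} \<times> UNIV) u Du" "t \<in> {0..T}"
  shows "((\<lambda>s. u (s, y)) has_vector_derivative Du (t, y) (1, 0)) (at t within {0..T})"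
proof -
  have D: "(u has_derivative Du (t, y)) (at (t, y) within {0..T} \<times> UNIV)"
    using assms by (auto simp: C1_deriv_def)
  have "((\<lambda>s. u (s, y)) has_derivative (\<lambda>h. Du (t, y) (h, 0))) (at t within {0..T})"
  proof (rule has_derivative_in_compose[where f = "\<lambda>s. (s, y)" and f' = "\<lambda>h. (h, 0)"])
    show "((\<lambda>s. (s, y)) has_derivative (\<lambda>h. (h, 0))) (at t within {0..T})"
      by (rule has_derivative_Pair[OF has_derivative_ident has_derivative_const])
    show "(u has_derivative Du (t, y)) (at (t, y) within (\<lambda>s. (s, y)) ` {0..T})"
      by (rule has_derivative_subset[OF D]) auto
  qed
  moreover have "(\<lambda>h. Du (t, y) (h, 0)) = (\<lambda>h. h *\<^sub>R Du (t, y) (1, 0))"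
  proof
    fix h
    show "Du (t, y) (h, 0) = h *\<^sub>R Du (t, y) (1, 0)"
      using linear_scale[OF has_derivative_linear[OF D], of h "(1, 0)"] by simp
  qed
  ultimately show ?thesis
    unfolding has_vector_derivative_def by (simp only:)
qed

lemma C1_deriv_space_slice:
  assumes "C1_deriv ({0..T} \<times> UNIV) u Du" "t \<in> {0..T}"
  shows "C1_deriv UNIV (\<lambda>y. u (t, y)) (\<lambda>y h. Du (t, y) (0, h))"
  unfolding C1_deriv_def
proof (intro conjI ballI allI)
  fix y
  show "((\<lambda>y. u (t, y)) has_derivative (\<lambda>h. Du (t, y) (0, h))) (at y)"
  proof (rule has_derivative_in_compose[where f = "\<lambda>y. (t, y)" and f' = "\<lambda>h. (0, h)"])
    show "((\<lambda>y. (t, y)) has_derivative (\<lambda>h. (0, h))) (at y)"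
      by (rule has_derivative_Pair[OF has_derivative_const has_derivative_ident])
    show "(u has_derivative Du (t, y)) (at (t, y) within (\<lambda>y. (t, y)) ` UNIV)"
      using assms(2) by (intro has_derivative_subset[OF C1_derivD(1)[OF assms(1)]]) auto
  qed
  show "continuous_on UNIV (\<lambda>y. Du (t, y) (0, h))" for h
    using assms(2)
    by (intro continuous_on_compose2[OF C1_derivD(2)[OF assms(1)]] continuous_intros) auto
qed

section \<open>Conservation laws and Gronwall's inequality\<close>

text \<open>By translation invariance of the integral, which is differentiated under the integral sign.\<close>

lemma integral_directional_derivative_eq_0:
  fixes \<phi> :: "'a::euclidean_space \<Rightarrow> real"
  assumes \<phi>: "C1_deriv UNIV \<phi> D\<phi>" and supp: "\<And>y. y \<notin> cbox a b \<Longrightarrow> \<phi> y = 0"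
  shows "integral (cbox a b) (\<lambda>y. D\<phi> y v) = 0"
proof -
  \<comment> \<open>One box contains the support box and all its translates by - s v with |s| \<le>
    1, so the domain of integration can stay fixed while s varies.\<close>
  obtain c where c: "cbox a b \<union> (\<lambda>(y, s). y - s *\<^sub>R v) ` (cbox a b \<times> {-1..1}) \<subseteq> cbox (-c) c"
  proof (rule bounded_subset_cbox_symmetric)
    have "compact ((\<lambda>(y, s). y - s *\<^sub>R v) ` (cbox a b \<times> {-1..1::real}))"
      unfolding case_prod_unfold
      by (intro compact_continuous_image continuous_intros compact_Times compact_cbox compact_Icc)
    then show "bounded (cbox a b \<union> (\<lambda>(y, s). y - s *\<^sub>R v) ` (cbox a b \<times> {-1..1::real}))"
      by (simp add: compact_imp_bounded)
  qed
  have cont: "continuous_on UNIV \<phi>" and contD: "continuous_on UNIV (\<lambda>y. D\<phi> y v)"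
    using C1_derivD[OF \<phi>] by auto
  have "((\<lambda>s. integral (cbox (-c) c) (\<lambda>y. \<phi> (y + s *\<^sub>R v))) has_vector_derivative
      integral (cbox (-c) c) (\<lambda>y. D\<phi> (y + 0 *\<^sub>R v) v)) (at 0 within {-1<..<1})"
  proof (rule leibniz_rule_vector_derivative[where f = "\<lambda>s y. \<phi> (y + s *\<^sub>R v)"
        and fx = "\<lambda>s y. D\<phi> (y + s *\<^sub>R v) v"])
    fix s :: real and y
    have "((\<lambda>s. \<phi> (y + s *\<^sub>R v)) has_derivative (\<lambda>h. D\<phi> (y + s *\<^sub>R v) (h *\<^sub>R v))) (at s within {-1<..<1})"
    proof (rule has_derivative_compose[where f = "\<lambda>s. y + s *\<^sub>R v" and f' = "\<lambda>h. h *\<^sub>R v"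
          and g = \<phi> and g' = "D\<phi> (y + s *\<^sub>R v)"])
      show "((\<lambda>s. y + s *\<^sub>R v) has_derivative (\<lambda>h. h *\<^sub>R v)) (at s within {-1<..<1})"
        by (rule has_derivative_eq_rhs,
          rule has_derivative_add[OF has_derivative_const
            has_derivative_scaleR_left[OF has_derivative_ident]]) simp
      show "(\<phi> has_derivative D\<phi> (y + s *\<^sub>R v)) (at (y + s *\<^sub>R v))"
        using C1_derivD(1)[OF \<phi>] by simp
    qed
    then show "((\<lambda>s. \<phi> (y + s *\<^sub>R v)) has_vector_derivative D\<phi> (y + s *\<^sub>R v) v)
        (at s within {-1<..<1})"
      unfolding has_vector_derivative_def
      by (simp add: linear_scale[OF has_derivative_linear[OF C1_derivD(1)[OF \<phi>]]])
  next
    fix s :: real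
    show "(\<lambda>y. \<phi> (y + s *\<^sub>R v)) integrable_on cbox (-c) c"
      by (intro integrable_continuous continuous_on_compose2[OF cont] continuous_intros) auto
  next
    show "continuous_on ({-1<..<1} \<times> cbox (-c) c) (\<lambda>(s, y). D\<phi> (y + s *\<^sub>R v) v)"
      unfolding case_prod_unfold
      by (intro continuous_on_compose2[OF contD] continuous_intros) auto
  qed auto
  \<comment> \<open>Translation does not change the integral, so the function of s differentiated
    above is constant.\<close>
  moreover have "integral (cbox (-c) c) (\<lambda>y. \<phi> (y + s *\<^sub>R v)) = integral (cbox a b) \<phi>"
    if "s \<in> {-1<..<1}" for s
  proof -
    have "(\<phi> has_integral integral (cbox a b) \<phi>) (cbox a b)"
      by (intro integrable_integral integrable_continuous continuous_on_subset[OF cont]) auto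
    from has_integral_affinity[OF this, of 1 "s *\<^sub>R v"]
    have "((\<lambda>y. \<phi> (y + s *\<^sub>R v)) has_integral integral (cbox a b) \<phi>) ((\<lambda>y. y - s *\<^sub>R v) ` cbox a b)"
      by simp
    then have "((\<lambda>y. \<phi> (y + s *\<^sub>R v)) has_integral integral (cbox a b) \<phi>) (cbox (-c) c)"
    proof (rule has_integral_on_superset)
      fix y assume "y \<notin> (\<lambda>y. y - s *\<^sub>R v) ` cbox a b"
      then have "y + s *\<^sub>R v \<notin> cbox a b"
        by (metis add_diff_cancel image_eqI)
      then show "\<phi> (y + s *\<^sub>R v) = 0" by (rule supp)
    next
      show "(\<lambda>y. y - s *\<^sub>R v) ` cbox a b \<subseteq> cbox (-c) c"
        using c that by fastforce
    qed
    then show ?thesis by (rule integral_unique)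
  qed
  then have "((\<lambda>s. integral (cbox (-c) c) (\<lambda>y. \<phi> (y + s *\<^sub>R v))) has_vector_derivative 0)
      (at 0 within {-1<..<1})"
    by (intro has_vector_derivative_transform[OF _ _ has_vector_derivative_const]) auto
  ultimately have "integral (cbox (-c) c) (\<lambda>y. D\<phi> y v) = 0"
    by (simp add: at_within_open[of 0 "{-1<..<1::real}"] vector_derivative_unique_at)
  \<comment> \<open>Outside the closed support box \<phi> vanishes on an open set, hence so does its
    derivative, and the box can be shrunk back.\<close>
  moreover have "integral (cbox (-c) c) (\<lambda>y. D\<phi> y v) = integral (cbox a b) (\<lambda>y. D\<phi> y v)"
  proof (rule integral_unique[OF has_integral_on_superset[OF integrable_integral]])
    show "(\<lambda>y. D\<phi> y v) integrable_on cbox a b"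
      by (intro integrable_continuous continuous_on_subset[OF contD]) auto
    show "cbox a b \<subseteq> cbox (-c) c" using c by auto
    fix y assume y: "y \<notin> cbox a b"
    have "(\<phi> has_derivative (\<lambda>h. 0)) (at y)"
    proof (rule has_derivative_transform_within_open[where s = "- cbox a b"])
      show "((\<lambda>y. 0) has_derivative (\<lambda>h. 0)) (at y)" by simp
    qed (use y supp in \<open>auto simp: closed_cbox open_Compl\<close>)
    then show "D\<phi> y v = 0"
      using C1_derivD(1)[OF \<phi>, of y] has_derivative_unique by (metis UNIV_I)
  qed
  ultimately show ?thesis by simp
qed

text \<open>The components decouple: \<open>F y \<bullet> v\<close> is differentiated in the
  direction v alone, so each term integrates to zero by translation invariance.\<close>

lemma integral_divergence_eq_0:
  fixes F :: "'a::euclidean_space \<Rightarrow> 'a"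
  assumes F: "C1_deriv UNIV F DF" and supp: "\<And>y. y \<notin> cbox a b \<Longrightarrow> F y = 0"
  shows "integral (cbox a b) (\<lambda>y. \<Sum>v\<in>Basis. DF y v \<bullet> v) = 0"
proof -
  have cont: "continuous_on (cbox a b) (\<lambda>y. DF y v \<bullet> v)" for v
    by (intro continuous_intros continuous_on_subset[OF C1_derivD(2)[OF F]]) auto
  have "integral (cbox a b) (\<lambda>y. DF y v \<bullet> v) = 0" for v
  proof (rule integral_directional_derivative_eq_0[where \<phi> = "\<lambda>y. F y \<bullet> v" and D\<phi> = "\<lambda>y h. DF y h \<bullet> v"])
    show "C1_deriv UNIV (\<lambda>y. F y \<bullet> v) (\<lambda>y h. DF y h \<bullet> v)"
      using C1_deriv_inner[OF F C1_deriv_const[of _ v]] by simp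
  qed (simp add: supp)
  then show ?thesis
    by (subst integral_sum) (auto intro: integrable_continuous cont)
qed

text \<open>The divergence of F has integral zero and may be added freely under the integral.
  Choosing F as the flux of a balance law leaves only its source terms in the derivative.\<close>

lemma has_vector_derivative_integral_conservation:
  fixes u :: "real \<times> 'a::euclidean_space \<Rightarrow> real" and F :: "real \<times> 'a \<Rightarrow> 'a"
  assumes u: "C1_deriv ({0..T} \<times> UNIV) u Du" and F: "C1_deriv ({0..T} \<times> UNIV) F DF"
    and supp: "\<And>t y. t \<in> {0..T} \<Longrightarrow> y \<notin> cbox a b \<Longrightarrow> F (t, y) = 0"
    and t: "t \<in> {0..T}"
  shows "((\<lambda>s. integral (cbox a b) (\<lambda>y. u (s, y))) has_vector_derivative
      integral (cbox a b) (\<lambda>y. Du (t, y) (1, 0) + (\<Sum>v\<in>Basis. DF (t, y) (0, v) \<bullet> v))) (at t within {0..T})"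
proof -
  have "((\<lambda>s. integral (cbox a b) (\<lambda>y. u (s, y))) has_vector_derivative
      integral (cbox a b) (\<lambda>y. Du (t, y) (1, 0))) (at t within {0..T})"
  proof (rule leibniz_rule_vector_derivative[where f = "\<lambda>s y. u (s, y)"
        and fx = "\<lambda>s y. Du (s, y) (1, 0)"])
    show "((\<lambda>s. u (s, y)) has_vector_derivative Du (s, y) (1, 0)) (at s within {0..T})"
      if "s \<in> {0..T}" for s y
      by (rule C1_deriv_time_slice[OF u that])
    show "(\<lambda>y. u (s, y)) integrable_on cbox a b" if "s \<in> {0..T}" for s
      using that
      by (intro integrable_continuous continuous_on_compose2[OF C1_derivD(3)[OF u]] continuous_intros) auto
    show "continuous_on ({0..T} \<times> cbox a b) (\<lambda>(s, y). Du (s, y) (1, 0))"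
      using continuous_on_subset[OF C1_derivD(2)[OF u], of "{0..T} \<times> cbox a b"]
      by (auto simp: case_prod_unfold)
  qed (use t in auto)
  moreover have "integral (cbox a b) (\<lambda>y. \<Sum>v\<in>Basis. DF (t, y) (0, v) \<bullet> v) = 0"
    by (rule integral_divergence_eq_0[OF C1_deriv_space_slice[OF F t] supp[OF t]])
  moreover have "integral (cbox a b) (\<lambda>y. Du (t, y) (1, 0) + (\<Sum>v\<in>Basis. DF (t, y) (0, v) \<bullet> v)) =
      integral (cbox a b) (\<lambda>y. Du (t, y) (1, 0)) + integral (cbox a b) (\<lambda>y. \<Sum>v\<in>Basis. DF (t, y) (0, v) \<bullet> v)"
    using t
    by (intro integral_add integrable_continuous continuous_on_sum continuous_on_inner continuous_on_const
      continuous_on_compose2[OF C1_derivD(2)[OF u]] continuous_on_compose2[OF C1_derivD(2)[OF F]]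
      continuous_on_Pair continuous_on_id) auto
  ultimately show ?thesis by simp
qed

text \<open>The product \<open>exp (- C * t) * Y t\<close> is nonincreasing and starts at 0;
  nonnegativity of Y does the rest. Derivatives are one-sided at 0 and T, so monotonicity is deduced
  from interior derivatives and continuity up to the boundary.\<close>

lemma gronwall_zero:
  fixes Y :: "real \<Rightarrow> real"
  assumes D: "\<And>t. t \<in> {0..T} \<Longrightarrow> \<exists>d. (Y has_vector_derivative d) (at t within {0..T}) \<and> d \<le> C * Y t"
    and "Y 0 = 0" and nonneg: "\<And>t. t \<in> {0..T} \<Longrightarrow> Y t \<ge> 0" and t: "t \<in> {0..T}"
  shows "Y t = 0"
proof -
  have "exp (- C * t) * Y t \<le> exp (- C * 0) * Y 0"
  proof (rule DERIV_nonpos_imp_decreasing_open[where f = "\<lambda>t. exp (- C * t) * Y t"])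
    show "0 \<le> t" using t by simp
    have "continuous_on {0..T} Y"
      unfolding continuous_on_eq_continuous_within
      using D has_vector_derivative_continuous by blast
    then show "continuous_on {0..t} (\<lambda>t. exp (- C * t) * Y t)"
      using t by (intro continuous_intros) (auto elim: continuous_on_subset)
    fix s assume s: "0 < s" "s < t"
    then obtain d where "(Y has_vector_derivative d) (at s within {0..T})" and le: "d \<le> C * Y s"
      using D[of s] t by auto
    then have "(Y has_real_derivative d) (at s)"
      using s t at_within_Icc_at[of 0 s T]
      by (simp add: has_real_derivative_iff_has_vector_derivative)
    then have "((\<lambda>t. exp (- C * t) * Y t) has_real_derivative exp (- C * s) * (d - C * Y s)) (at s)"
      by (auto intro!: derivative_eq_intros simp: algebra_simps)
    moreover have "exp (- C * s) * (d - C * Y s) \<le> 0"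
      using le by (simp add: mult_le_0_iff)
    ultimately show "\<exists>y. ((\<lambda>t. exp (- C * t) * Y t) has_real_derivative y) (at s) \<and> y \<le> 0"
      by blast
  qed
  then show ?thesis using assms(2) nonneg[OF t] by (simp add: mult_le_0_iff)
qed

section \<open>Relativistic velocity and cone weights\<close>

lemma C1_deriv_subset: "C1_deriv S u Du \<Longrightarrow> R \<subseteq> S \<Longrightarrow> C1_deriv R u Du"
  unfolding C1_deriv_def by (blast intro: has_derivative_subset continuous_on_subset)

lemma C1_deriv_eq_rhs: "C1_deriv S u Du \<Longrightarrow> (\<And>z h. Du z h = Du' z h) \<Longrightarrow> C1_deriv S u Du'"
  by (subgoal_tac "Du = Du'") auto

text \<open>The Japanese bracket; its gradient is \<open>hat\<close>.\<close>

definition jp :: "real^2 \<Rightarrow> real" where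
  "jp x = sqrt (1 + (norm x)\<^sup>2)"

lemma jp_ge_1: "1 \<le> jp x"
  by (simp add: jp_def)

lemma jp_pos [simp]: "0 < jp x" "jp x \<noteq> 0"
  using jp_ge_1[of x] by linarith+

lemma norm_le_jp: "norm x \<le> jp x"
  unfolding jp_def by (rule real_le_rsqrt) simp

lemma hat_eq: "hat x = x /\<^sub>R jp x"
  by (simp add: hat_def jp_def)

lemma norm_hat_le: "norm (hat x) \<le> 1"
  using norm_le_jp[of x] by (simp add: hat_eq field_simps)

lemma perp_nth [simp]: "perp a $ 1 = - a $ 2" "perp a $ 2 = a $ 1"
  by (simp_all add: perp_def)

lemma bounded_linear_perp: "bounded_linear perp"
  by (intro linear_conv_bounded_linear[THEN iffD1] linearI)
    (simp_all add: vec_eq_iff forall_2)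

lemma inner_2: "(a :: real^2) \<bullet> b = a $ 1 * b $ 1 + a $ 2 * b $ 2"
  by (simp add: inner_vec_def sum_2)

lemma sum_Basis_real2: "(\<Sum>v\<in>Basis. g v) = g (axis 1 1) + g (axis 2 (1::real) :: real^2)"
proof -
  have "Basis = {axis 1 1, axis 2 1 :: real^2}"
    by (auto simp: Basis_vec_def) (metis exhaust_2)
  then show ?thesis unfolding \<open>Basis = _\<close> by (simp add: axis_eq_axis)
qed

lemma norm_perp [simp]: "norm (perp a) = norm a"
  by (simp add: norm_eq_sqrt_inner inner_2)

lemma C1_deriv_jp: "C1_deriv UNIV jp (\<lambda>x h. hat x \<bullet> h)"
  unfolding C1_deriv_def
proof (intro conjI ballI allI)
  fix x :: "real^2"
  have jp: "jp = (\<lambda>x. sqrt (1 + x \<bullet> x))"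
    by (simp add: jp_def power2_norm_eq_inner fun_eq_iff)
  have "0 < 1 + x \<bullet> x" by (simp add: add_pos_nonneg)
  then show "(jp has_derivative (\<bullet>) (hat x)) (at x)"
    unfolding jp
    by (auto intro!: derivative_eq_intros simp: hat_eq jp inner_commute field_simps)
  fix h
  show "continuous_on UNIV (\<lambda>x. hat x \<bullet> h)"
    unfolding hat_eq jp
    by (intro continuous_intros) (metis add_pos_nonneg inner_ge_zero less_numeral_extra(1,3) real_sqrt_eq_zero_cancel_iff)
qed

text \<open>As a matrix this is (I - a a^T) / \<open>jp p\<close> with a = \<open>hat p\<close>,
  which is symmetric.\<close>

definition Dhat :: "real^2 \<Rightarrow> real^2 \<Rightarrow> real^2" where
  "Dhat p h = h /\<^sub>R jp p - ((hat p \<bullet> h) / (jp p)\<^sup>2) *\<^sub>R p"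

lemma C1_deriv_inverse:
  fixes u :: "'a::real_normed_vector \<Rightarrow> real"
  assumes u: "C1_deriv S u Du" and nz: "\<And>z. z \<in> S \<Longrightarrow> u z \<noteq> 0"
  shows "C1_deriv S (\<lambda>z. inverse (u z)) (\<lambda>z h. - (Du z h / (u z)\<^sup>2))"
  unfolding C1_deriv_def
proof (intro conjI ballI allI)
  show "((\<lambda>z. inverse (u z)) has_derivative (\<lambda>h. - (Du z h / (u z)\<^sup>2))) (at z within S)" if "z \<in> S" for z
    by (rule has_derivative_eq_rhs[OF Deriv.has_derivative_inverse[OF nz[OF that] C1_derivD(1)[OF u that]]])
      (simp add: fun_eq_iff power2_eq_square field_simps)
  show "continuous_on S (\<lambda>z. - (Du z h / (u z)\<^sup>2))" for h
    using nz by (intro continuous_intros C1_derivD(2,3)[OF u]) auto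
qed

lemma C1_deriv_hat: "C1_deriv UNIV hat Dhat"
proof -
  have "C1_deriv UNIV (\<lambda>p. inverse (jp p) *\<^sub>R p)
      (\<lambda>p h. inverse (jp p) *\<^sub>R h + (- ((hat p \<bullet> h) / (jp p)\<^sup>2)) *\<^sub>R p)"
    by (rule C1_deriv_scaleR[OF C1_deriv_inverse[OF C1_deriv_jp] C1_deriv_linear[OF bounded_linear_ident]]) simp
  then show ?thesis
    by (simp add: Dhat_def[abs_def] hat_eq[abs_def])
qed

text \<open>A symmetric matrix followed by a rotation through a right angle has trace zero. So the
  magnetic force has no divergence in p, and the transport equation can be put into conservation
  form.\<close>

lemma divergence_perp_hat: "(\<Sum>v\<in>Basis. perp (Dhat p v) \<bullet> v) = 0"
  by (simp add: sum_Basis_real2 inner_2 axis_def Dhat_def field_simps hat_eq)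

text \<open>A cone around the centre q that shrinks at speed m. Squaring makes the truncation
  continuously differentiable across the boundary of the cone; \<open>jp\<close> instead of the norm
  avoids the singularity at the centre. In position space m = 1, the bound for \<open>hat\<close>;
  in momentum space m is a bound for the force.\<close>

definition cone_weight :: "real \<Rightarrow> real \<Rightarrow> real^2 \<Rightarrow> real \<times> (real^2) \<Rightarrow> real" where
  "cone_weight c m q = (\<lambda>(t, x). (max 0 (c - m * t - jp (x - q)))\<^sup>2)"

definition Dcone_weight :: "real \<Rightarrow> real \<Rightarrow> real^2 \<Rightarrow> real \<times> (real^2) \<Rightarrow> real \<times> (real^2) \<Rightarrow> real" where
  "Dcone_weight c m q = (\<lambda>(t, x) (\<tau>, h).
    - (2 * max 0 (c - m * t - jp (x - q)) * (m * \<tau> + hat (x - q) \<bullet> h)))"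

lemma C1_deriv_max_square: "C1_deriv UNIV (\<lambda>s::real. (max 0 s)\<^sup>2) (\<lambda>s h. 2 * max 0 s * h)"
  unfolding C1_deriv_def
proof (intro conjI ballI allI)
  fix s :: real
  show "((\<lambda>s::real. (max 0 s)\<^sup>2) has_derivative (\<lambda>h. 2 * max 0 s * h)) (at s)"
  proof (cases s "0::real" rule: linorder_cases)
    case less
    have "((\<lambda>s::real. 0::real) has_derivative (\<lambda>h. 0)) (at s)" by simp
    then have "((\<lambda>s::real. (max 0 s)\<^sup>2) has_derivative (\<lambda>h. 0)) (at s)"
      by (rule has_derivative_transform_within_open[where s = "{..<0}"]) (use less in auto)
    then show ?thesis using less by (simp add: max_def)
  next
    case greater
    have "((\<lambda>s::real. s\<^sup>2) has_derivative (\<lambda>h. 2 * s * h)) (at s)"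
      by (auto intro!: derivative_eq_intros)
    then have "((\<lambda>s::real. (max 0 s)\<^sup>2) has_derivative (\<lambda>h. 2 * s * h)) (at s)"
      by (rule has_derivative_transform_within_open[where s = "{0<..}"]) (use greater in auto)
    then show ?thesis using greater by simp
  next
    case equal
    \<comment> \<open>At the kink s = 0 the difference quotient lies between - |h| and |h|.\<close>
    have "((\<lambda>h::real. ((max 0 h)\<^sup>2 - (max 0 0)\<^sup>2) / h) \<longlongrightarrow> 0) (at 0)"
    proof (rule tendsto_sandwich[where f = "\<lambda>h. - \<bar>h\<bar>" and h = "\<lambda>h. \<bar>h\<bar>"])
      show "\<forall>\<^sub>F h in at 0. - \<bar>h\<bar> \<le> ((max 0 h)\<^sup>2 - (max 0 0)\<^sup>2) / (h::real)"
        "\<forall>\<^sub>F h in at 0. ((max 0 h)\<^sup>2 - (max 0 0)\<^sup>2) / h \<le> \<bar>h::real\<bar>"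
        by (auto simp: max_def power2_eq_square)
      show "((\<lambda>h::real. - \<bar>h\<bar>) \<longlongrightarrow> 0) (at 0)" "((\<lambda>h::real. \<bar>h\<bar>) \<longlongrightarrow> 0) (at 0)"
        by (auto intro!: tendsto_eq_intros)
    qed
    then have "((\<lambda>s::real. (max 0 s)\<^sup>2) has_real_derivative 0) (at 0)"
      by (simp add: DERIV_def)
    moreover have "(*) 0 = (\<lambda>h::real. 0::real)" by (simp add: fun_eq_iff)
    ultimately show ?thesis using equal by (simp add: has_field_derivative_def)
  qed
  show "continuous_on UNIV (\<lambda>s::real. 2 * max 0 s * h)" for h
    by (intro continuous_intros)
qed

lemma C1_deriv_cone_weight: "C1_deriv UNIV (cone_weight c m q) (Dcone_weight c m q)"
proof -
  have "C1_deriv UNIV (\<lambda>z::real \<times> (real^2). snd z - q) (\<lambda>z h. snd h - 0)"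
    by (intro C1_deriv_diff C1_deriv_linear[OF bounded_linear_snd] C1_deriv_const)
  from C1_deriv_compose[OF this C1_deriv_jp subset_UNIV]
  have "C1_deriv UNIV (\<lambda>z::real \<times> (real^2). jp (snd z - q)) (\<lambda>z h. hat (snd z - q) \<bullet> snd h)"
    by simp
  moreover have "C1_deriv UNIV (\<lambda>z::real \<times> (real^2). c - m * fst z) (\<lambda>z h. 0 - m * fst h)"
    by (intro C1_deriv_diff C1_deriv_const C1_deriv_linear bounded_linear_mult_right
      bounded_linear_compose[OF bounded_linear_mult_right bounded_linear_fst])
  ultimately have "C1_deriv UNIV (\<lambda>z. c - m * fst z - jp (snd z - q))
      (\<lambda>z h. 0 - m * fst h - hat (snd z - q) \<bullet> snd h)"
    by (rule C1_deriv_diff[rotated])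
  from C1_deriv_compose[OF this C1_deriv_max_square subset_UNIV]
  show ?thesis
    unfolding cone_weight_def Dcone_weight_def case_prod_unfold
    by (rule C1_deriv_eq_rhs) (auto simp: algebra_simps)
qed

lemma cone_weight_nonneg [simp]: "0 \<le> cone_weight c m q z"
  by (simp add: cone_weight_def case_prod_unfold)

lemma cone_weight_eq_0_iff: "cone_weight c m q (t, x) = 0 \<longleftrightarrow> c - m * t \<le> jp (x - q)"
  by (auto simp: cone_weight_def max_def)

text \<open>The cone shrinks at speed m and the gradient \<open>hat\<close> of \<open>jp\<close> has
  norm at most 1, so motion with speed at most m cannot raise the weight. Where the weight is zero
  its derivative vanishes too, hence the conditional hypothesis.\<close>

lemma Dcone_weight_nonpos:
  assumes "cone_weight c m q (t, x) \<noteq> 0 \<Longrightarrow> norm h \<le> m"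
  shows "Dcone_weight c m q (t, x) (1, h) \<le> 0"
proof (cases "c - m * t \<le> jp (x - q)")
  case True
  then show ?thesis by (simp add: Dcone_weight_def)
next
  case False
  then have "norm h \<le> m" using assms by (simp add: cone_weight_eq_0_iff)
  moreover have "\<bar>hat (x - q) \<bullet> h\<bar> \<le> norm (hat (x - q)) * norm h" by (rule Cauchy_Schwarz_ineq2)
  moreover have "norm (hat (x - q)) * norm h \<le> 1 * norm h"
    by (intro mult_right_mono norm_hat_le) simp
  ultimately have "0 \<le> m + hat (x - q) \<bullet> h" by linarith
  then show ?thesis by (simp add: Dcone_weight_def)
qed

section \<open>The equations in terms of total derivatives\<close>

lemma C1_deriv_nth:
  fixes u :: "'a::real_normed_vector \<Rightarrow> real^'n"
  shows "C1_deriv S u Du \<Longrightarrow> C1_deriv S (\<lambda>z. u z $ i) (\<lambda>z h. Du z h $ i)"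
  using C1_deriv_compose[OF _ C1_deriv_linear[OF bounded_linear_vec_nth] subset_UNIV, of S u Du i]
  by simp

lemma C1_deriv_linear_compose:
  fixes A :: "'a::real_normed_vector \<Rightarrow> 'b::euclidean_space"
  assumes A: "bounded_linear A" and G: "C1_deriv R G DG" and sub: "A ` S \<subseteq> R"
  shows "C1_deriv S (\<lambda>z. G (A z)) (\<lambda>z h. DG (A z) (A h))"
  by (rule C1_deriv_compose[OF C1_deriv_linear[OF A] G sub])

lemma bounded_linear_omit_momentum:
  "bounded_linear (\<lambda>z::'a::real_normed_vector \<times> 'b::real_normed_vector \<times> 'c::real_normed_vector. (fst z, fst (snd z)))"
  by (intro bounded_linear_Pair bounded_linear_fst bounded_linear_compose[OF bounded_linear_fst bounded_linear_snd])

lemma bounded_linear_omit_position: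
  "bounded_linear (\<lambda>z::'a::real_normed_vector \<times> 'b::real_normed_vector \<times> 'c::real_normed_vector. (fst z, snd (snd z)))"
  by (intro bounded_linear_Pair bounded_linear_fst bounded_linear_compose[OF bounded_linear_snd bounded_linear_snd])

lemma pd_UNIV_eq:
  fixes g :: "'a::euclidean_space \<Rightarrow> 'b::real_normed_vector"
  shows "C1_deriv UNIV g Dg \<Longrightarrow> pd UNIV b g x = Dg x b"
  unfolding pd_def using C1_derivD(1)[of UNIV g Dg x] frechet_derivative_at[of g "Dg x" x] by simp

text \<open>Since T is positive, derivatives within \<open>{0..T}\<close> are unique even at the
  endpoints, so the derivative chosen by \<open>pd\<close> is the slice of the total
  derivative.\<close>

lemma time_deriv_eq:
  assumes u: "C1_deriv ({0..T} \<times> UNIV) u Du" and t: "t \<in> {0..T}" and T: "0 < T"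
  shows "time_deriv T (\<lambda>s. u (s, y)) t = Du (t, y) (1, 0)"
proof -
  have D: "((\<lambda>s. u (s, y)) has_derivative (\<lambda>h. h *\<^sub>R Du (t, y) (1, 0))) (at t within cbox 0 T)"
    using C1_deriv_time_slice[OF u t] by (simp add: has_vector_derivative_def)
  then have "((\<lambda>s. u (s, y)) has_derivative frechet_derivative (\<lambda>s. u (s, y)) (at t within cbox 0 T)) (at t within cbox 0 T)"
    using frechet_derivative_works differentiable_def by blast
  from frechet_derivative_unique_within_closed_interval[OF _ _ this D] T t
  show ?thesis by (simp add: pd_def)
qed

lemma partial_eq:
  assumes "C1_deriv ({0..T} \<times> UNIV) u Du" "t \<in> {0..T}"
  shows "partial i (\<lambda>y. u (t, y)) x = Du (t, x) (0, axis i 1)"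
  unfolding partial_def by (rule pd_UNIV_eq[OF C1_deriv_space_slice[OF assms]])

lemma partial_fst_eq:
  fixes u :: "real \<times> (real^2) \<times> (real^2) \<Rightarrow> 'b::real_normed_vector"
  assumes u: "C1_deriv ({0..T} \<times> UNIV) u Du" and t: "t \<in> {0..T}"
  shows "partial i (\<lambda>y. u (t, y, p)) x = Du (t, x, p) (0, axis i 1, 0)"
proof -
  have "C1_deriv UNIV (\<lambda>y. (y, p)) (\<lambda>y h. (h, 0))"
    by (intro C1_deriv_Pair C1_deriv_const C1_deriv_linear bounded_linear_ident)
  from C1_deriv_compose[OF this C1_deriv_space_slice[OF u t] subset_UNIV]
  show ?thesis unfolding partial_def by (rule pd_UNIV_eq)
qed

lemma partial_snd_eq:
  fixes u :: "real \<times> (real^2) \<times> (real^2) \<Rightarrow> 'b::real_normed_vector"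
  assumes u: "C1_deriv ({0..T} \<times> UNIV) u Du" and t: "t \<in> {0..T}"
  shows "partial i (\<lambda>q. u (t, x, q)) p = Du (t, x, p) (0, 0, axis i 1)"
proof -
  have "C1_deriv UNIV (\<lambda>q. (x, q)) (\<lambda>y h. (0, h))"
    by (intro C1_deriv_Pair C1_deriv_const C1_deriv_linear bounded_linear_ident)
  from C1_deriv_compose[OF this C1_deriv_space_slice[OF u t] subset_UNIV]
  show ?thesis unfolding partial_def by (rule pd_UNIV_eq)
qed

lemma linear_real2_expansion:
  fixes A :: "real^2 \<Rightarrow> 'b::real_vector"
  assumes "linear A"
  shows "A h = (\<Sum>i\<in>UNIV. (h $ i) *\<^sub>R A (axis i 1))"
  using linear_componentwise_expansion[OF assms, of h] by (simp add: sum_Basis_real2 inner_axis sum_2)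

text \<open>By linearity the time, position and momentum terms combine to a single derivative in the
  characteristic direction.\<close>

lemma vlasov_eq_imp_transport:
  assumes f: "C1_deriv ({0..T} \<times> UNIV) f Df" and T: "0 < T" and eq: "vlasov_eq T f E B"
    and t: "t \<in> {0..T}"
  shows "Df (t, x, p) (1, hat p, E (t, x) - B (t, x) *\<^sub>R perp (hat p)) = 0"
proof -
  let ?L = "Df (t, x, p)" and ?K = "E (t, x) - B (t, x) *\<^sub>R perp (hat p)"
  have L: "bounded_linear ?L"
    using has_derivative_bounded_linear[OF C1_derivD(1)[OF f]] t by auto
  have lin: "linear (\<lambda>h. ?L (0, h, 0))" "linear (\<lambda>h. ?L (0, 0, h))"
    by (intro bounded_linear.linear bounded_linear_compose[OF L] bounded_linear_Pair
      bounded_linear_zero bounded_linear_ident)+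
  note linear_real2_expansion[OF lin(1), of "hat p"] linear_real2_expansion[OF lin(2), of ?K]
  moreover have "?L (1, hat p, ?K) = ?L (1, 0, 0) + ?L (0, hat p, 0) + ?L (0, 0, ?K)"
    by (simp flip: linear_add[OF bounded_linear.linear[OF L]])
  moreover have "?L (1, 0, 0) + (\<Sum>i\<in>UNIV. hat p $ i * ?L (0, axis i 1, 0)) +
      (\<Sum>i\<in>UNIV. ?K $ i * ?L (0, 0, axis i 1)) = 0"
    using eq[unfolded vlasov_eq_def, rule_format, OF t, of x p]
    unfolding partial_fst_eq[OF f t] partial_snd_eq[OF f t]
      time_deriv_eq[OF f t T, of "(x, p)", unfolded zero_prod_def] .
  ultimately show ?thesis by (simp only: real_scaleR_def)
qed

section \<open>Momentum support\<close>

text \<open>The maximum principle for \<open>f\<^sup>2 W - \<epsilon> t\<close>, with \<open>W\<close> a product of two cone weights, shows that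
  \<open>f\<close> vanishes at a point if it vanishes initially on its backward domain of dependence.\<close>

lemma transport_support:
  fixes f :: "real \<times> (real^2) \<times> (real^2) \<Rightarrow> real"
  assumes f: "C1_deriv ({0..T} \<times> UNIV) f Df"
    and transport: "\<And>t x p. t \<in> {0..T} \<Longrightarrow>
      Df (t, x, p) (1, hat p, E (t, x) - B (t, x) *\<^sub>R perp (hat p)) = 0"
    and force: "\<And>t x. t \<in> {0..T} \<Longrightarrow> norm x \<le> R \<Longrightarrow> norm (E (t, x)) + \<bar>B (t, x)\<bar> \<le> M"
    and "0 \<le> M"
    and init: "\<And>x p. P \<le> norm p \<Longrightarrow> f (0, x, p) = 0"
    and t0: "t0 \<in> {0..T}" and x0: "cone_weight R 1 0 (t0, x0) \<noteq> 0" and p0: "P + M * T + 2 \<le> norm p0"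
  shows "f (t0, x0, p0) = 0"
proof (rule ccontr)
  assume f0: "f (t0, x0, p0) \<noteq> 0"
  let ?S = "{0..T} \<times> (UNIV :: ((real^2) \<times> (real^2)) set)"
  define \<alpha> where "\<alpha> = cone_weight R 1 0"
  \<comment> \<open>At time t0 this cone still contains its centre p0, because 2 exceeds
    \<open>jp 0\<close> = 1. At time 0 it reaches less than M T + 2 away from p0, where momenta
    still have norm at least P.\<close>
  define \<beta> where "\<beta> = cone_weight (M * t0 + 2) M p0"
  define u where "u = (\<lambda>z. f z * f z * (\<alpha> (fst z, fst (snd z)) * \<beta> (fst z, snd (snd z))))"
  define Du where "Du = (\<lambda>z h. f z * f z *
      (\<alpha> (fst z, fst (snd z)) * Dcone_weight (M * t0 + 2) M p0 (fst z, snd (snd z)) (fst h, snd (snd h)) +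
       Dcone_weight R 1 0 (fst z, fst (snd z)) (fst h, fst (snd h)) * \<beta> (fst z, snd (snd z))) +
      (f z * Df z h + Df z h * f z) * (\<alpha> (fst z, fst (snd z)) * \<beta> (fst z, snd (snd z))))"
  have \<alpha>: "C1_deriv ?S (\<lambda>z. \<alpha> (fst z, fst (snd z)))
      (\<lambda>z h. Dcone_weight R 1 0 (fst z, fst (snd z)) (fst h, fst (snd h)))"
    unfolding \<alpha>_def
    by (rule C1_deriv_linear_compose[OF bounded_linear_omit_momentum C1_deriv_cone_weight subset_UNIV])
  have \<beta>: "C1_deriv ?S (\<lambda>z. \<beta> (fst z, snd (snd z)))
      (\<lambda>z h. Dcone_weight (M * t0 + 2) M p0 (fst z, snd (snd z)) (fst h, snd (snd h)))"
    unfolding \<beta>_def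
    by (rule C1_deriv_linear_compose[OF bounded_linear_omit_position C1_deriv_cone_weight subset_UNIV])
  have u: "C1_deriv ?S u Du"
    unfolding u_def Du_def
    by (rule C1_deriv_mult[OF C1_deriv_mult[OF f f] C1_deriv_mult[OF \<alpha> \<beta>]])
  have u_nonneg: "0 \<le> u z" for z
    by (simp add: u_def \<alpha>_def \<beta>_def)
  have "u (t0, x0, p0) \<noteq> 0"
  proof -
    have "\<beta> (t0, p0) \<noteq> 0" by (simp add: \<beta>_def cone_weight_eq_0_iff jp_def)
    then show ?thesis using f0 x0 by (simp add: u_def \<alpha>_def)
  qed
  then have u0: "0 < u (t0, x0, p0)" using u_nonneg[of "(t0, x0, p0)"] by linarith
  \<comment> \<open>Small enough to keep h positive at the given point; the term - \<epsilon> t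
    makes the derivative of h strictly negative wherever that of u along the characteristic
    direction is nonpositive.\<close>
  define \<epsilon> where "\<epsilon> = u (t0, x0, p0) / (2 * (T + 1))"
  have \<epsilon>: "0 < \<epsilon>" using u0 t0 by (simp add: \<epsilon>_def)
  define h where "h = (\<lambda>z. u z - \<epsilon> * fst z)"
  have h: "C1_deriv ?S h (\<lambda>z k. Du z k - \<epsilon> * fst k)"
    unfolding h_def
    by (intro C1_deriv_diff u C1_deriv_linear bounded_linear_compose[OF bounded_linear_mult_right bounded_linear_fst])
  have h0: "0 < h (t0, x0, p0)"
  proof -
    have "\<epsilon> * t0 \<le> \<epsilon> * (T + 1)" using t0 \<epsilon> by (intro mult_left_mono) auto
    also have "\<dots> = u (t0, x0, p0) / 2" using t0 by (simp add: \<epsilon>_def field_simps)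
    finally show ?thesis using u0 by (simp add: h_def)
  qed
  let ?K = "{0..T} \<times> cball (0 :: real^2) R \<times> cball p0 (M * T + 2)"
  \<comment> \<open>Off the compact K one of the two cone weights vanishes, so a positive maximum
    over K is a maximum over the whole domain.\<close>
  have outside: "h z \<le> 0" if "z \<in> ?S" "z \<notin> ?K" for z
  proof -
    obtain t x p where z: "z = (t, x, p)" by (cases z) auto
    have "M * t0 \<le> M * T" "0 \<le> M * t" using t0 \<open>0 \<le> M\<close> that(1) z by (auto intro: mult_left_mono)
    then have "\<alpha> (t, x) = 0 \<or> \<beta> (t, p) = 0"
      using that z norm_le_jp[of x] norm_le_jp[of "p - p0"]
      by (auto simp: \<alpha>_def \<beta>_def cone_weight_eq_0_iff dist_norm norm_minus_commute)
    then have "u z = 0" by (auto simp: u_def z)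
    then show ?thesis using \<epsilon> that by (auto simp: h_def)
  qed
  have inK: "(t0, x0, p0) \<in> ?K"
    using outside[of "(t0, x0, p0)"] h0 t0 by fastforce
  have "compact ?K" by (intro compact_Times compact_cball compact_Icc)
  moreover have "continuous_on ?K h"
    by (rule continuous_on_subset[OF C1_derivD(3)[OF h]]) auto
  ultimately obtain z1 where z1: "z1 \<in> ?K" "\<And>z. z \<in> ?K \<Longrightarrow> h z \<le> h z1"
    using continuous_attains_sup[of ?K h] inK by blast
  have h1: "0 < h z1" using z1(2)[OF inK] h0 by linarith
  have max: "h z \<le> h z1" if "z \<in> ?S" for z
    using z1(2)[of z] outside[OF that] h1 by force
  obtain t x p where z1_eq: "z1 = (t, x, p)" by (cases z1) auto
  have t: "t \<in> {0..T}" using z1 z1_eq by auto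
  have "0 \<le> \<epsilon> * t" using t \<epsilon> by simp
  then have "u z1 \<noteq> 0" using h1 by (auto simp: h_def z1_eq)
  then have fz: "f z1 \<noteq> 0" and \<alpha>z: "\<alpha> (t, x) \<noteq> 0" and \<beta>z: "\<beta> (t, p) \<noteq> 0"
    by (auto simp: u_def z1_eq)
  \<comment> \<open>Where \<beta> is nonzero at time 0 the momentum has norm at least P, so f
    vanishes there and u cannot be positive.\<close>
  have "t \<noteq> 0"
  proof
    assume "t = 0"
    then have "jp (p - p0) < M * t0 + 2" using \<beta>z by (simp add: \<beta>_def cone_weight_eq_0_iff)
    moreover have "M * t0 \<le> M * T" using t0 \<open>0 \<le> M\<close> by (auto intro: mult_left_mono)
    moreover have "norm p0 \<le> norm p + norm (p - p0)"
      using norm_triangle_ineq4[of p "p - p0"] by simp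
    ultimately have "P \<le> norm p" using p0 norm_le_jp[of "p - p0"] by linarith
    then show False using init[of p x] fz \<open>t = 0\<close> z1_eq by simp
  qed
  then have "0 < t" using t by simp
  let ?k = "E (t, x) - B (t, x) *\<^sub>R perp (hat p)"
  let ?v = "(1, hat p, ?k)"
  \<comment> \<open>On the support of \<alpha> the force has norm at most M, so neither weight
    increases in the characteristic direction.\<close>
  have "norm x \<le> R"
    using \<alpha>z t norm_le_jp[of x] by (simp add: \<alpha>_def cone_weight_eq_0_iff)
  then have "norm (E (t, x)) + \<bar>B (t, x)\<bar> \<le> M" by (rule force[OF t])
  moreover have "norm ?k \<le> norm (E (t, x)) + \<bar>B (t, x)\<bar> * norm (hat p)"
    by (rule order_trans[OF norm_triangle_ineq4]) simp
  moreover have "\<bar>B (t, x)\<bar> * norm (hat p) \<le> \<bar>B (t, x)\<bar>"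
    using norm_hat_le[of p] by (simp add: mult_left_le)
  ultimately have "norm ?k \<le> M" by linarith
  then have "\<alpha> (t, x) * Dcone_weight (M * t0 + 2) M p0 (t, p) (1, ?k) \<le> 0"
    by (intro mult_nonneg_nonpos Dcone_weight_nonpos) (simp_all add: \<alpha>_def)
  moreover have "Dcone_weight R 1 0 (t, x) (1, hat p) * \<beta> (t, p) \<le> 0"
    by (intro mult_nonpos_nonneg Dcone_weight_nonpos norm_hat_le) (simp add: \<beta>_def)
  ultimately have "f z1 * f z1 * (\<alpha> (t, x) * Dcone_weight (M * t0 + 2) M p0 (t, p) (1, ?k) +
      Dcone_weight R 1 0 (t, x) (1, hat p) * \<beta> (t, p)) \<le> 0"
    by (intro mult_nonneg_nonpos[OF zero_le_square] add_nonpos_nonpos)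
  moreover have "Df z1 ?v = 0" unfolding z1_eq by (rule transport[OF t])
  ultimately have "Du z1 ?v \<le> 0"
    by (simp add: Du_def z1_eq)
  \<comment> \<open>The maximum is compared with earlier points on the line through it in the
    characteristic direction. These stay in the time interval even if t = T, and for small positive
    s the value of h there is strictly larger.\<close>
  have "((\<lambda>s. h (z1 - s *\<^sub>R ?v)) has_derivative (\<lambda>s. Du z1 (- s *\<^sub>R ?v) - \<epsilon> * fst (- s *\<^sub>R ?v)))
      (at 0 within {0..t})"
  proof (rule has_derivative_in_compose[where f = "\<lambda>s. z1 - s *\<^sub>R ?v" and f' = "\<lambda>s. - s *\<^sub>R ?v"
        and g = h and g' = "\<lambda>k. Du z1 k - \<epsilon> * fst k"])
    have "((\<lambda>s. z1 - s *\<^sub>R ?v) has_derivative (\<lambda>s. 0 - s *\<^sub>R ?v)) (at 0 within {0..t})"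
      by (intro has_derivative_diff has_derivative_const has_derivative_scaleR_left has_derivative_ident)
    then show "((\<lambda>s. z1 - s *\<^sub>R ?v) has_derivative (\<lambda>s. - s *\<^sub>R ?v)) (at 0 within {0..t})"
      by (simp only: diff_0 scaleR_minus_left)
    have "(h has_derivative (\<lambda>k. Du z1 k - \<epsilon> * fst k)) (at z1 within ?S)"
      using C1_derivD(1)[OF h, of z1] t by (auto simp: z1_eq)
    then have "(h has_derivative (\<lambda>k. Du z1 k - \<epsilon> * fst k)) (at z1 within (\<lambda>s. z1 - s *\<^sub>R ?v) ` {0..t})"
      by (rule has_derivative_subset) (use t in \<open>auto simp: z1_eq\<close>)
    then show "(h has_derivative (\<lambda>k. Du z1 k - \<epsilon> * fst k))
        (at (z1 - 0 *\<^sub>R ?v) within (\<lambda>s. z1 - s *\<^sub>R ?v) ` {0..t})"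
      by (simp only: scaleR_zero_left diff_0_right)
  qed
  moreover have "Du z1 (- s *\<^sub>R ?v) - \<epsilon> * fst (- s *\<^sub>R ?v) = (\<epsilon> - Du z1 ?v) * s" for s
  proof -
    have "linear (Du z1)"
      using C1_derivD(1)[OF u, of z1] t by (intro has_derivative_linear) (auto simp: z1_eq)
    then have "Du z1 (- s *\<^sub>R ?v) = - s *\<^sub>R Du z1 ?v" by (rule linear_scale)
    then show ?thesis by (simp add: algebra_simps)
  qed
  moreover define \<phi> where "\<phi> = (\<lambda>s. h (z1 - s *\<^sub>R ?v))"
  ultimately have "(\<phi> has_real_derivative (\<epsilon> - Du z1 ?v)) (at 0 within {0..t})"
    unfolding has_field_derivative_def by (simp only:)
  moreover have "0 < \<epsilon> - Du z1 ?v" using \<epsilon> \<open>Du z1 ?v \<le> 0\<close> by linarith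
  ultimately have "\<exists>d>0. \<forall>s>0. 0 + s \<in> {0..t} \<longrightarrow> s < d \<longrightarrow> \<phi> 0 < \<phi> (0 + s)"
    by (rule has_real_derivative_pos_inc_right)
  then obtain d where "0 < d" and d: "\<forall>s>0. s \<in> {0..t} \<longrightarrow> s < d \<longrightarrow> \<phi> 0 < \<phi> s"
    unfolding add_0 by blast
  define s where "s = min t (d / 2)"
  have "0 < s" "s \<in> {0..t}" "s < d" using \<open>0 < t\<close> \<open>0 < d\<close> by (auto simp: s_def)
  then have "\<phi> 0 < \<phi> s" using d by blast
  then have "h z1 < h (z1 - s *\<^sub>R ?v)" by (simp only: \<phi>_def scaleR_zero_left diff_0_right)
  moreover have "z1 - s *\<^sub>R ?v \<in> ?S" using t \<open>s \<in> {0..t}\<close> by (auto simp: z1_eq)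
  ultimately show False using max[of "z1 - s *\<^sub>R ?v"] by linarith
qed

section \<open>Energy estimates\<close>

lemma sum_Basis_prod:
  fixes g :: "'a::euclidean_space \<times> 'b::euclidean_space \<Rightarrow> 'c::comm_monoid_add"
  shows "(\<Sum>v\<in>Basis. g v) = (\<Sum>i\<in>Basis. g (i, 0)) + (\<Sum>j\<in>Basis. g (0, j))"
proof -
  have "inj_on (\<lambda>u. (u::'a, 0::'b)) Basis" "inj_on (\<lambda>u. (0::'a, u::'b)) Basis"
    by (auto intro!: inj_onI Pair_inject)
  then show ?thesis
    unfolding Basis_prod_def
    by (subst sum.union_disjoint) (auto simp: Basis_prod_def sum.reindex)
qed

text \<open>A weighted Poynting identity. The derivatives of D and b combine to a divergence, the
  current leaves - 2 w D \<bullet> J, and the derivatives of the weight leave a nonpositive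
  quadratic form. The current enters only through the continuous majorant G.\<close>

lemma maxwell_energy:
  fixes D :: "real \<times> (real^2) \<Rightarrow> real^2" and b :: "real \<times> (real^2) \<Rightarrow> real"
  assumes D: "C1_deriv ({0..T} \<times> UNIV) D DD" and b: "C1_deriv ({0..T} \<times> UNIV) b Db"
    and eqs: "\<And>x. DD (t, x) (1, 0) $ 1 - Db (t, x) (0, axis 2 1) = - J x $ 1"
      "\<And>x. DD (t, x) (1, 0) $ 2 + Db (t, x) (0, axis 1 1) = - J x $ 2"
      "\<And>x. Db (t, x) (1, 0) + DD (t, x) (0, axis 1 1) $ 2 - DD (t, x) (0, axis 2 1) $ 1 = 0"
    and w: "w = cone_weight R 1 0"
    and supp: "\<And>t x. t \<in> {0..T} \<Longrightarrow> x \<notin> cbox l u \<Longrightarrow> w (t, x) = 0"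
    and t: "t \<in> {0..T}"
    and G: "\<And>x. - 2 * w (t, x) * (D (t, x) \<bullet> J x) \<le> G x" "continuous_on (cbox l u) G"
  obtains I where "((\<lambda>s. integral (cbox l u) (\<lambda>x. w (s, x) * (D (s, x) \<bullet> D (s, x) + b (s, x) * b (s, x))))
      has_vector_derivative I) (at t within {0..T})" "I \<le> integral (cbox l u) G"
proof -
  define Dw where "Dw = Dcone_weight R 1 0"
  have wC: "C1_deriv ({0..T} \<times> UNIV) w Dw"
    unfolding w Dw_def by (rule C1_deriv_subset[OF C1_deriv_cone_weight subset_UNIV])
  define De where "De = (\<lambda>z h. w z * (D z \<bullet> DD z h + DD z h \<bullet> D z + (b z * Db z h + Db z h * b z)) +
    Dw z h * (D z \<bullet> D z + b z * b z))"
  have e: "C1_deriv ({0..T} \<times> UNIV) (\<lambda>z. w z * (D z \<bullet> D z + b z * b z)) De"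
    unfolding De_def
    by (rule C1_deriv_mult[OF wC C1_deriv_add[OF C1_deriv_inner[OF D D] C1_deriv_mult[OF b b]]])
  \<comment> \<open>The weighted Poynting flux, with components 2 w b D1' and 2 w b D2', where (D1',
    D2') = (D2, - D1).\<close>
  define F where "F = (\<lambda>z. (w z * b z) *\<^sub>R ((- 2) *\<^sub>R perp (D z)))"
  define DF where "DF = (\<lambda>z h. (w z * b z) *\<^sub>R ((- 2) *\<^sub>R perp (DD z h)) +
    (w z * Db z h + Dw z h * b z) *\<^sub>R ((- 2) *\<^sub>R perp (D z)))"
  have "bounded_linear (\<lambda>a. (- 2) *\<^sub>R perp a)"
    by (rule bounded_linear_compose[OF bounded_linear_scaleR_right bounded_linear_perp])
  from C1_deriv_compose[OF D C1_deriv_linear[OF this] subset_UNIV]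
  have F: "C1_deriv ({0..T} \<times> UNIV) F DF"
    unfolding F_def DF_def by (rule C1_deriv_scaleR[OF C1_deriv_mult[OF wC b]])
  have le: "De (t, x) (1, 0) + (\<Sum>v\<in>Basis. DF (t, x) (0, v) \<bullet> v) \<le> G x" for x
  proof -
    define \<sigma> where "\<sigma> = 2 * max 0 (R - t - jp x)"
    have "0 \<le> \<sigma>" by (simp add: \<sigma>_def)
    let ?h1 = "hat x $ 1" and ?h2 = "hat x $ 2"
    let ?D1 = "D (t, x) $ 1" and ?D2 = "D (t, x) $ 2" and ?b = "b (t, x)"
    have Dw: "Dw (t, x) (1, 0) = - \<sigma>" "Dw (t, x) (0, axis 1 1) = - \<sigma> * ?h1"
        "Dw (t, x) (0, axis 2 1) = - \<sigma> * ?h2"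
      by (simp_all add: Dw_def Dcone_weight_def \<sigma>_def inner_axis)
    have ev: "DD (t, x) (1, 0) $ 1 = Db (t, x) (0, axis 2 1) - J x $ 1"
      "DD (t, x) (1, 0) $ 2 = - Db (t, x) (0, axis 1 1) - J x $ 2"
      "Db (t, x) (1, 0) = DD (t, x) (0, axis 2 1) $ 1 - DD (t, x) (0, axis 1 1) $ 2"
      using eqs[of x] by linarith+
    have ax: "axis 2 (1::real) $ (1::2) = 0" "axis 1 (1::real) $ (2::2) = 0"
      by (simp_all add: axis_def)
    let ?c = "?h1 * ?D2 - ?h2 * ?D1"
    have "De (t, x) (1, 0) + (\<Sum>v\<in>Basis. DF (t, x) (0, v) \<bullet> v) =
        - 2 * w (t, x) * (?D1 * J x $ 1 + ?D2 * J x $ 2) -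
        \<sigma> * (?D1 * ?D1 + ?D2 * ?D2 + ?b * ?b + 2 * ?b * ?c)"
      unfolding De_def DF_def sum_Basis_real2
      by (simp add: inner_2 inner_axis Dw ev ax algebra_simps)
    \<comment> \<open>Here \<open>?c\<close> is the scalar cross product of \<open>hat x\<close> and
      D. As \<open>hat x\<close> has norm at most 1, its square is at most |D|^2, and completing the
      square in b gives the sign.\<close>
    moreover have "0 \<le> ?D1 * ?D1 + ?D2 * ?D2 + ?b * ?b + 2 * ?b * ?c"
    proof -
      have "(hat x \<bullet> (- perp (D (t, x))))\<^sup>2 \<le> (norm (hat x) * norm (- perp (D (t, x))))\<^sup>2"
        by (rule abs_le_square_iff[THEN iffD1])
          (use Cauchy_Schwarz_ineq2[of "hat x" "- perp (D (t, x))"] in simp)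
      also have "\<dots> \<le> (1 * norm (D (t, x)))\<^sup>2"
        using norm_hat_le[of x] by (intro power_mono mult_mono) auto
      finally have "?c\<^sup>2 \<le> ?D1 * ?D1 + ?D2 * ?D2"
        by (simp add: power2_norm_eq_inner inner_2 algebra_simps)
      moreover have "0 \<le> (?b + ?c)\<^sup>2" by simp
      ultimately show ?thesis by (simp add: power2_sum power2_eq_square algebra_simps)
    qed
    ultimately have "De (t, x) (1, 0) + (\<Sum>v\<in>Basis. DF (t, x) (0, v) \<bullet> v) \<le>
        - 2 * w (t, x) * (?D1 * J x $ 1 + ?D2 * J x $ 2)"
      using \<open>0 \<le> \<sigma>\<close> by simp
    then show ?thesis using G(1)[of x] by (simp add: inner_2)
  qed
  show thesis
  proof (rule that)
    show "((\<lambda>s. integral (cbox l u) (\<lambda>x. w (s, x) * (D (s, x) \<bullet> D (s, x) + b (s, x) * b (s, x))))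
      has_vector_derivative integral (cbox l u) (\<lambda>x. De (t, x) (1, 0) + (\<Sum>v\<in>Basis. DF (t, x) (0, v) \<bullet> v)))
      (at t within {0..T})"
      by (rule has_vector_derivative_integral_conservation[OF e F _ t]) (simp add: F_def supp)
    show "integral (cbox l u) (\<lambda>x. De (t, x) (1, 0) + (\<Sum>v\<in>Basis. DF (t, x) (0, v) \<bullet> v)) \<le> integral (cbox l u) G"
      using t
      by (intro integral_le le integrable_continuous G(2) continuous_on_add continuous_on_sum
        continuous_on_inner continuous_on_const continuous_on_compose2[OF C1_derivD(2)[OF e]]
        continuous_on_compose2[OF C1_derivD(2)[OF F]] continuous_on_Pair continuous_on_id) auto
  qed
qed

text \<open>The density w g^2 is transported by a velocity field without divergence in (x, p), so
  its balance is a derivative in the characteristic direction. The weight does not increase in that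
  direction, and the equation for g supplies the source 2 w g s.\<close>

lemma vlasov_energy:
  fixes g :: "real \<times> (real^2) \<times> (real^2) \<Rightarrow> real"
  assumes g: "C1_deriv ({0..T} \<times> UNIV) g Dg" and E: "C1_deriv ({0..T} \<times> UNIV) E DE"
    and B: "C1_deriv ({0..T} \<times> UNIV) B DB"
    and eq: "\<And>x p. Dg (t, x, p) (1, hat p, E (t, x) - B (t, x) *\<^sub>R perp (hat p)) = s (x, p)"
    and w: "w = cone_weight R 1 0"
    and supp: "\<And>t x p. t \<in> {0..T} \<Longrightarrow> (x, p) \<notin> cbox l u \<Longrightarrow> w (t, x) * (g (t, x, p) * g (t, x, p)) = 0"
    and t: "t \<in> {0..T}"
    and G: "\<And>x p. (x, p) \<in> cbox l u \<Longrightarrow> 2 * w (t, x) * (g (t, x, p) * s (x, p)) \<le> G (x, p)"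
      "continuous_on (cbox l u) G"
  obtains I where "((\<lambda>s. integral (cbox l u) (\<lambda>z. w (s, fst z) * (g (s, z) * g (s, z))))
      has_vector_derivative I) (at t within {0..T})" "I \<le> integral (cbox l u) G"
proof -
  let ?S = "{0..T} \<times> (UNIV :: ((real^2) \<times> (real^2)) set)"
  define Dw where "Dw = Dcone_weight R 1 0"
  define \<pi>x where "\<pi>x = (\<lambda>z::real \<times> (real^2) \<times> (real^2). (fst z, fst (snd z)))"
  define mom where "mom = (\<lambda>z::real \<times> (real^2) \<times> (real^2). snd (snd z))"
  have lin: "bounded_linear \<pi>x" "bounded_linear mom"
    unfolding \<pi>x_def mom_def
    by (rule bounded_linear_omit_momentum,
      rule bounded_linear_compose[OF bounded_linear_snd bounded_linear_snd])
  have img: "\<pi>x ` ?S \<subseteq> {0..T} \<times> UNIV" by (auto simp: \<pi>x_def)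
  have wC: "C1_deriv ?S (\<lambda>z. w (\<pi>x z)) (\<lambda>z h. Dw (\<pi>x z) (\<pi>x h))"
    unfolding w Dw_def by (rule C1_deriv_linear_compose[OF lin(1) C1_deriv_cone_weight subset_UNIV])
  have EC: "C1_deriv ?S (\<lambda>z. E (\<pi>x z)) (\<lambda>z h. DE (\<pi>x z) (\<pi>x h))"
    by (rule C1_deriv_linear_compose[OF lin(1) E img])
  have BC: "C1_deriv ?S (\<lambda>z. B (\<pi>x z)) (\<lambda>z h. DB (\<pi>x z) (\<pi>x h))"
    by (rule C1_deriv_linear_compose[OF lin(1) B img])
  have hatC: "C1_deriv ?S (\<lambda>z. hat (mom z)) (\<lambda>z h. Dhat (mom z) (mom h))"
    by (rule C1_deriv_linear_compose[OF lin(2) C1_deriv_hat subset_UNIV])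
  have perpC: "C1_deriv ?S (\<lambda>z. perp (hat (mom z))) (\<lambda>z h. perp (Dhat (mom z) (mom h)))"
    by (rule C1_deriv_compose[OF hatC C1_deriv_linear[OF bounded_linear_perp] subset_UNIV])
  define e where "e = (\<lambda>z. w (\<pi>x z) * (g z * g z))"
  define De where "De = (\<lambda>z h. w (\<pi>x z) * (g z * Dg z h + Dg z h * g z) + Dw (\<pi>x z) (\<pi>x h) * (g z * g z))"
  have e: "C1_deriv ?S e De"
    unfolding e_def De_def by (rule C1_deriv_mult[OF wC C1_deriv_mult[OF g g]])
  define K where "K = (\<lambda>z. E (\<pi>x z) - B (\<pi>x z) *\<^sub>R perp (hat (mom z)))"
  define DK where "DK = (\<lambda>z h. DE (\<pi>x z) (\<pi>x h) -
    (B (\<pi>x z) *\<^sub>R perp (Dhat (mom z) (mom h)) + DB (\<pi>x z) (\<pi>x h) *\<^sub>R perp (hat (mom z))))"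
  have K: "C1_deriv ?S K DK"
    unfolding K_def DK_def by (rule C1_deriv_diff[OF EC C1_deriv_scaleR[OF BC perpC]])
  \<comment> \<open>The flux is the density times the phase space velocity (\<open>hat p\<close>,
    K).\<close>
  define F where "F = (\<lambda>z. (e z *\<^sub>R hat (mom z), e z *\<^sub>R K z))"
  define DF where "DF = (\<lambda>z h. (e z *\<^sub>R Dhat (mom z) (mom h) + De z h *\<^sub>R hat (mom z), e z *\<^sub>R DK z h + De z h *\<^sub>R K z))"
  have F: "C1_deriv ?S F DF"
    unfolding F_def DF_def by (rule C1_deriv_Pair[OF C1_deriv_scaleR[OF e hatC] C1_deriv_scaleR[OF e K]])
  have div: "De (t, x, p) (1, 0) + (\<Sum>v\<in>Basis. DF (t, x, p) (0, v) \<bullet> v) = De (t, x, p) (1, hat p, K (t, x, p))" for x p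
  proof -
    let ?L = "De (t, x, p)"
    have L: "bounded_linear ?L"
      using has_derivative_bounded_linear[OF C1_derivD(1)[OF e]] t by auto
    have "DE (t, x) (0, 0) = 0" "DB (t, x) (0, 0) = 0"
      using linear_0[OF has_derivative_linear[OF C1_derivD(1)[OF E, of "(t, x)"]]]
        linear_0[OF has_derivative_linear[OF C1_derivD(1)[OF B, of "(t, x)"]]] t
      by (auto simp: zero_prod_def)
    \<comment> \<open>E and B do not depend on the momentum, so only the variation of
      \<open>hat p\<close> in the magnetic term is left.\<close>
    then have DK0: "DK (t, x, p) (0, 0, j) = - B (t, x) *\<^sub>R perp (Dhat p j)" for j
      by (simp add: DK_def \<pi>x_def mom_def)
    have lin: "linear (\<lambda>h. ?L (0, h, 0))" "linear (\<lambda>h. ?L (0, 0, h))"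
      by (intro bounded_linear.linear bounded_linear_compose[OF L] bounded_linear_Pair
        bounded_linear_zero bounded_linear_ident)+
    have "(\<Sum>i\<in>Basis. DF (t, x, p) (0, i, 0) \<bullet> (i, 0)) = (\<Sum>i\<in>Basis. (hat p \<bullet> i) *\<^sub>R ?L (0, i, 0))"
      by (simp add: DF_def mom_def Dhat_def algebra_simps)
    also have "\<dots> = ?L (0, hat p, 0)"
      by (rule linear_componentwise_expansion[OF lin(1), symmetric])
    finally have 1: "(\<Sum>i\<in>Basis. DF (t, x, p) (0, i, 0) \<bullet> (i, 0)) = ?L (0, hat p, 0)" .
    have "(\<Sum>j\<in>Basis. DF (t, x, p) (0, 0, j) \<bullet> (0, j)) =
        (\<Sum>j\<in>Basis. (K (t, x, p) \<bullet> j) *\<^sub>R ?L (0, 0, j) - e (t, x, p) * B (t, x) * (perp (Dhat p j) \<bullet> j))"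
      by (simp add: DF_def DK0 inner_diff_left mult_ac)
    also have "\<dots> = (\<Sum>j\<in>Basis. (K (t, x, p) \<bullet> j) *\<^sub>R ?L (0, 0, j))"
      unfolding sum_subtractf sum_distrib_left[symmetric] divergence_perp_hat by simp
    also have "\<dots> = ?L (0, 0, K (t, x, p))"
      by (rule linear_componentwise_expansion[OF lin(2), symmetric])
    finally have 2: "(\<Sum>j\<in>Basis. DF (t, x, p) (0, 0, j) \<bullet> (0, j)) = ?L (0, 0, K (t, x, p))" .
    have "?L (1, hat p, K (t, x, p)) = ?L (1, 0, 0) + ?L (0, hat p, 0) + ?L (0, 0, K (t, x, p))"
      by (simp flip: linear_add[OF bounded_linear.linear[OF L]])
    then show ?thesis
      unfolding sum_Basis_prod 1 2 by (simp add: zero_prod_def)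
  qed
  have le: "De (t, x, p) (1, 0) + (\<Sum>v\<in>Basis. DF (t, x, p) (0, v) \<bullet> v) \<le> G (x, p)" if "(x, p) \<in> cbox l u" for x p
  proof -
    have "Dw (t, x) (1, hat p) * (g (t, x, p) * g (t, x, p)) \<le> 0"
      unfolding Dw_def by (intro mult_nonpos_nonneg Dcone_weight_nonpos norm_hat_le zero_le_square)
    moreover have "De (t, x, p) (1, hat p, K (t, x, p)) =
        2 * w (t, x) * (g (t, x, p) * s (x, p)) + Dw (t, x) (1, hat p) * (g (t, x, p) * g (t, x, p))"
      using eq[of x p] by (simp add: De_def K_def \<pi>x_def mom_def)
    ultimately show ?thesis unfolding div using G(1)[OF that] by linarith
  qed
  show thesis
  proof (rule that)
    have "((\<lambda>s. integral (cbox l u) (\<lambda>z. e (s, z)))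
      has_vector_derivative integral (cbox l u) (\<lambda>z. De (t, z) (1, 0) + (\<Sum>v\<in>Basis. DF (t, z) (0, v) \<bullet> v)))
      (at t within {0..T})"
    proof (rule has_vector_derivative_integral_conservation[OF e F _ t])
      fix t and y :: "(real^2) \<times> (real^2)" assume "t \<in> {0..T}" "y \<notin> cbox l u"
      then show "F (t, y) = 0"
        using supp[of t "fst y" "snd y"] by (simp add: F_def e_def \<pi>x_def zero_prod_def)
    qed
    then show "((\<lambda>s. integral (cbox l u) (\<lambda>z. w (s, fst z) * (g (s, z) * g (s, z))))
      has_vector_derivative integral (cbox l u) (\<lambda>z. De (t, z) (1, 0) + (\<Sum>v\<in>Basis. DF (t, z) (0, v) \<bullet> v)))
      (at t within {0..T})"
      by (simp add: e_def \<pi>x_def)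
    show "integral (cbox l u) (\<lambda>z. De (t, z) (1, 0) + (\<Sum>v\<in>Basis. DF (t, z) (0, v) \<bullet> v)) \<le> integral (cbox l u) G"
    proof (rule integral_le)
      show "(\<lambda>z. De (t, z) (1, 0) + (\<Sum>v\<in>Basis. DF (t, z) (0, v) \<bullet> v)) integrable_on cbox l u"
        using t
        by (intro integrable_continuous continuous_on_add continuous_on_sum
          continuous_on_inner continuous_on_const continuous_on_compose2[OF C1_derivD(2)[OF e]]
          continuous_on_compose2[OF C1_derivD(2)[OF F]] continuous_on_Pair continuous_on_id) auto
      show "G integrable_on cbox l u" by (rule integrable_continuous[OF G(2)])
      show "De (t, z) (1, 0) + (\<Sum>v\<in>Basis. DF (t, z) (0, v) \<bullet> v) \<le> G z" if "z \<in> cbox l u" for z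
        using le[of "fst z" "snd z"] that by simp
    qed
  qed
qed

section \<open>Currents of momentum-supported densities\<close>

lemma current_density_eq_integral:
  fixes g :: "(real^2) \<times> (real^2) \<Rightarrow> real"
  assumes cont: "continuous_on (cbox l u) (\<lambda>p. g (x, p))" and supp: "\<And>p. p \<notin> cbox l u \<Longrightarrow> g (x, p) = 0"
  shows "current_density g x = (4 * pi) *\<^sub>R integral (cbox l u) (\<lambda>p. g (x, p) *\<^sub>R hat p)"
proof -
  have "continuous_on (cbox l u) hat"
    by (rule continuous_on_subset[OF C1_derivD(3)[OF C1_deriv_hat] subset_UNIV])
  with cont have c: "continuous_on (cbox l u) (\<lambda>p. g (x, p) *\<^sub>R hat p)"
    by (rule continuous_on_scaleR)
  then have "set_integrable lborel (cbox l u) (\<lambda>p. g (x, p) *\<^sub>R hat p)"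
    unfolding set_integrable_def by (rule borel_integrable_compact[OF compact_cbox])
  from set_borel_integral_eq_integral(2)[OF this]
  have "integral (cbox l u) (\<lambda>p. g (x, p) *\<^sub>R hat p) = (LINT p|lborel. indicator (cbox l u) p *\<^sub>R (g (x, p) *\<^sub>R hat p))"
    by (simp add: set_lebesgue_integral_def)
  also have "\<dots> = (LINT p|lborel. g (x, p) *\<^sub>R hat p)"
    using supp by (intro Bochner_Integration.integral_cong) (auto simp: indicator_def)
  finally show ?thesis by (simp add: current_density_def)
qed

text \<open>Pointwise in p, Young's inequality bounds - 2 k (d \<bullet> \<open>hat p\<close>) by
  k^2 + |d|^2, as \<open>hat p\<close> has norm at most 1. Integrating |d|^2 over the momentum box
  produces its volume; this is where bounded momentum support enters.\<close>

lemma current_density_energy_bound: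
  fixes g g' :: "(real^2) \<times> (real^2) \<Rightarrow> real"
  assumes cont: "continuous_on (cbox l u) (\<lambda>p. g (x, p))" "continuous_on (cbox l u) (\<lambda>p. g' (x, p))"
    and supp: "\<And>p. p \<notin> cbox l u \<Longrightarrow> g (x, p) = 0" "\<And>p. p \<notin> cbox l u \<Longrightarrow> g' (x, p) = 0"
  shows "- 2 * (d \<bullet> (current_density g x - current_density g' x)) \<le>
    4 * pi * (integral (cbox l u) (\<lambda>p. (g (x, p) - g' (x, p)) * (g (x, p) - g' (x, p))) + measure lborel (cbox l u) * (d \<bullet> d))"
proof -
  define k where "k = (\<lambda>p. g (x, p) - g' (x, p))"
  have hat: "continuous_on (cbox l u) hat"
    by (rule continuous_on_subset[OF C1_derivD(3)[OF C1_deriv_hat] subset_UNIV])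
  have k: "continuous_on (cbox l u) k"
    unfolding k_def by (intro continuous_intros cont)
  have J: "current_density g x = (4 * pi) *\<^sub>R integral (cbox l u) (\<lambda>p. g (x, p) *\<^sub>R hat p)"
    by (rule current_density_eq_integral[OF cont(1) supp(1)])
  have J': "current_density g' x = (4 * pi) *\<^sub>R integral (cbox l u) (\<lambda>p. g' (x, p) *\<^sub>R hat p)"
    by (rule current_density_eq_integral[OF cont(2) supp(2)])
  have "current_density g x - current_density g' x = (4 * pi) *\<^sub>R integral (cbox l u) (\<lambda>p. k p *\<^sub>R hat p)"
    unfolding J J'
      scaleR_right_diff_distrib[symmetric] k_def scaleR_left_diff_distrib
    by (intro arg_cong[of _ _ "scaleR (4 * pi)"] integral_diff[symmetric] integrable_continuous
      continuous_on_scaleR cont hat)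
  then have "- 2 * (d \<bullet> (current_density g x - current_density g' x)) =
      4 * pi * (- 2 * (d \<bullet> integral (cbox l u) (\<lambda>p. k p *\<^sub>R hat p)))"
    by simp
  also have "- 2 * (d \<bullet> integral (cbox l u) (\<lambda>p. k p *\<^sub>R hat p)) =
      integral (cbox l u) (\<lambda>p. - 2 * (d \<bullet> (k p *\<^sub>R hat p)))"
  proof -
    have "(\<lambda>p. k p *\<^sub>R hat p) integrable_on cbox l u"
      by (intro integrable_continuous continuous_on_scaleR k hat)
    moreover have "bounded_linear (\<lambda>v. - 2 * (d \<bullet> v))"
      by (rule bounded_linear_compose[OF bounded_linear_mult_right bounded_linear_inner_right])
    ultimately show ?thesis
      by (rule integral_linear[unfolded o_def, symmetric])
  qed
  also have "\<dots> \<le> integral (cbox l u) (\<lambda>p. k p * k p + d \<bullet> d)"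
  proof (rule integral_le)
    fix p
    have "\<bar>d \<bullet> hat p\<bar> \<le> norm d"
      using Cauchy_Schwarz_ineq2[of d "hat p"] norm_hat_le[of p] mult_left_le[of "norm (hat p)" "norm d"] by simp
    then have "(d \<bullet> hat p)\<^sup>2 \<le> d \<bullet> d"
      unfolding power2_norm_eq_inner[symmetric] by (rule abs_le_square_iff[THEN iffD1, OF order_trans]) simp
    moreover have "0 \<le> (k p + d \<bullet> hat p)\<^sup>2" by simp
    ultimately show "- 2 * (d \<bullet> (k p *\<^sub>R hat p)) \<le> k p * k p + d \<bullet> d"
      by (simp add: power2_sum power2_eq_square algebra_simps)
  qed (intro integrable_continuous continuous_intros k hat)+
  also have "\<dots> = integral (cbox l u) (\<lambda>p. k p * k p) + measure lborel (cbox l u) * (d \<bullet> d)"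
    by (subst integral_add) (auto intro!: integrable_continuous continuous_intros k)
  finally show ?thesis by (simp add: k_def)
qed

lemma maxwell_eqs_imp_derivs:
  fixes E :: "real \<times> (real^2) \<Rightarrow> real^2"
  assumes E: "C1_deriv ({0..T} \<times> UNIV) E DE" and B: "C1_deriv ({0..T} \<times> UNIV) B DB"
    and T: "0 < T" and eq: "maxwell_eqs T U f E B" and t: "t \<in> {0..T}"
  shows "DE (t, x) (1, 0) $ 1 - DB (t, x) (0, axis 2 1) = - current_density (\<lambda>z. f (t, z)) x $ 1 - apply_Cb4 (U t) x $ 1"
    "DE (t, x) (1, 0) $ 2 + DB (t, x) (0, axis 1 1) = - current_density (\<lambda>z. f (t, z)) x $ 2 - apply_Cb4 (U t) x $ 2"
    "DB (t, x) (1, 0) + DE (t, x) (0, axis 1 1) $ 2 - DE (t, x) (0, axis 2 1) $ 1 = 0"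
  using eq[unfolded maxwell_eqs_def, rule_format, OF t, of x]
  unfolding time_deriv_eq[OF B t T] time_deriv_eq[OF C1_deriv_nth[OF E] t T] partial_eq[OF B t]
    partial_eq[OF C1_deriv_nth[OF E] t]
  by blast+

section \<open>Uniqueness\<close>

lemma continuous_on_compact_norm_bound:
  assumes "compact K" "continuous_on K (h :: 'a::topological_space \<Rightarrow> 'b::real_normed_vector)"
  shows "\<exists>N\<ge>0. \<forall>z\<in>K. norm (h z) \<le> N"
proof -
  have "bounded (h ` K)" by (intro compact_imp_bounded compact_continuous_image assms)
  then show ?thesis unfolding bounded_pos by (auto intro: less_imp_le)
qed

lemma integral_cbox_lincomb:
  fixes f h :: "'a::euclidean_space \<Rightarrow> real"
  assumes "continuous_on (cbox l u) f" "continuous_on (cbox l u) h"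
  shows "integral (cbox l u) (\<lambda>x. \<alpha> * (f x + \<beta> * h x)) =
    \<alpha> * (integral (cbox l u) f + \<beta> * integral (cbox l u) h)"
proof -
  have "integral (cbox l u) (\<lambda>x. f x + \<beta> * h x) = integral (cbox l u) f + integral (cbox l u) (\<lambda>x. \<beta> * h x)"
    by (intro integral_add integrable_continuous continuous_intros assms)
  then show ?thesis by (simp only: integral_mult_right)
qed

text \<open>The statement is pointwise so that the cone can be adapted to (t0, x0). The fields are
  then bounded on the part of space it covers, whatever their growth at infinity.\<close>

lemma CVM_unique_at:
  assumes T: "0 < T"
    and C1: "Ck_on 1 ({0..T} \<times> UNIV) f" "Ck_on 1 ({0..T} \<times> UNIV) E" "Ck_on 1 ({0..T} \<times> UNIV) B"
      "Ck_on 1 ({0..T} \<times> UNIV) f'" "Ck_on 1 ({0..T} \<times> UNIV) E'" "Ck_on 1 ({0..T} \<times> UNIV) B'"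
    and sol: "CVM T U f0 E0 B0 f E B" "CVM T U f0 E0 B0 f' E' B'"
    and f0: "\<And>x p. P \<le> norm p \<Longrightarrow> f0 (x, p) = 0"
    and t0: "t0 \<in> {0..T}"
  shows "E (t0, x0) = E' (t0, x0) \<and> B (t0, x0) = B' (t0, x0) \<and> f (t0, x0, p0) = f' (t0, x0, p0)"
proof -
  obtain Df DE DB Df' DE' DB' where
    f: "C1_deriv ({0..T} \<times> UNIV) f Df" and E: "C1_deriv ({0..T} \<times> UNIV) E DE" and
    B: "C1_deriv ({0..T} \<times> UNIV) B DB" and f': "C1_deriv ({0..T} \<times> UNIV) f' Df'" and
    E': "C1_deriv ({0..T} \<times> UNIV) E' DE'" and B': "C1_deriv ({0..T} \<times> UNIV) B' DB'"
    using C1[THEN Ck_on_1_imp_C1_deriv] by blast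
  have vlasov: "vlasov_eq T f E B" "vlasov_eq T f' E' B'"
    and maxwell: "maxwell_eqs T U f E B" "maxwell_eqs T U f' E' B'"
    and init: "\<And>x p. f (0, x, p) = f0 (x, p)" "\<And>x p. f' (0, x, p) = f0 (x, p)"
      "\<And>x. E (0, x) = E' (0, x)" "\<And>x. B (0, x) = B' (0, x)"
    using sol by (auto simp: CVM_def)
  note tr = vlasov_eq_imp_transport[OF f T vlasov(1)]
  note tr' = vlasov_eq_imp_transport[OF f' T vlasov(2)]
  \<comment> \<open>Since t0 \<le> T, the cone of this size still contains x0 in its interior at
    time t0.\<close>
  define R where "R = T + jp x0 + 1"
  have "0 < R" using T jp_pos(1)[of x0] by (simp add: R_def add_pos_pos)
  define w where "w = cone_weight R 1 0"
  have w0: "w (t0, x0) \<noteq> 0" using t0 by (simp add: w_def cone_weight_eq_0_iff R_def)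
  have w_nonneg: "0 \<le> w z" for z by (simp add: w_def)
  have w_supp: "norm x \<le> R" if "t \<in> {0..T}" "w (t, x) \<noteq> 0" for t x
    using that norm_le_jp[of x] by (simp add: w_def cone_weight_eq_0_iff)
  have w_cont: "continuous_on A w" for A
    unfolding w_def by (rule continuous_on_subset[OF C1_derivD(3)[OF C1_deriv_cone_weight] subset_UNIV])

  \<comment> \<open>Both forces are bounded by a common M on a compact set containing the
    cone.\<close>
  have "continuous_on ({0..T} \<times> cball 0 R) (\<lambda>z. (norm (E z) + \<bar>B z\<bar>) + (norm (E' z) + \<bar>B' z\<bar>))"
    by (intro continuous_intros continuous_on_subset[OF C1_derivD(3)[OF E]] continuous_on_subset[OF C1_derivD(3)[OF B]]
      continuous_on_subset[OF C1_derivD(3)[OF E']] continuous_on_subset[OF C1_derivD(3)[OF B']]) auto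
  from continuous_on_compact_norm_bound[OF compact_Times[OF compact_Icc compact_cball] this]
  obtain M where "0 \<le> M"
    and M: "\<forall>z\<in>{0..T} \<times> cball 0 R. norm ((norm (E z) + \<bar>B z\<bar>) + (norm (E' z) + \<bar>B' z\<bar>)) \<le> M"
    by blast
  have force: "norm (E (t, x)) + \<bar>B (t, x)\<bar> \<le> M" "norm (E' (t, x)) + \<bar>B' (t, x)\<bar> \<le> M"
    if "t \<in> {0..T}" "norm x \<le> R" for t x
  proof -
    have "(norm (E (t, x)) + \<bar>B (t, x)\<bar>) + (norm (E' (t, x)) + \<bar>B' (t, x)\<bar>) \<le> M"
      using M that by fastforce
    then show "norm (E (t, x)) + \<bar>B (t, x)\<bar> \<le> M" "norm (E' (t, x)) + \<bar>B' (t, x)\<bar> \<le> M"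
      using norm_ge_zero[of "E (t, x)"] norm_ge_zero[of "E' (t, x)"] by linarith+
  qed
  \<comment> \<open>The momentum bound of \<open>transport_support\<close> for this M, common to
    both solutions.\<close>
  define A where "A = P + M * T + 2"
  have f_supp: "f (t, x, p) = 0" if t: "t \<in> {0..T}" and x: "w (t, x) \<noteq> 0" and p: "A \<le> norm p" for t x p
  proof (rule transport_support[OF f _ _ \<open>0 \<le> M\<close> _ t])
    show "Df (t, x, p) (1, hat p, E (t, x) - B (t, x) *\<^sub>R perp (hat p)) = 0" if "t \<in> {0..T}" for t x p
      by (rule tr[OF that])
    show "norm (E (t, x)) + \<bar>B (t, x)\<bar> \<le> M" if "t \<in> {0..T}" "norm x \<le> R" for t x
      by (rule force(1)[OF that])
    show "f (0, x, p) = 0" if "P \<le> norm p" for x p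
      using f0[OF that] by (simp add: init)
    show "cone_weight R 1 0 (t, x) \<noteq> 0" using x by (simp add: w_def)
    show "P + M * T + 2 \<le> norm p" using p by (simp add: A_def)
  qed
  have f'_supp: "f' (t, x, p) = 0" if t: "t \<in> {0..T}" and x: "w (t, x) \<noteq> 0" and p: "A \<le> norm p" for t x p
  proof (rule transport_support[OF f' _ _ \<open>0 \<le> M\<close> _ t])
    show "Df' (t, x, p) (1, hat p, E' (t, x) - B' (t, x) *\<^sub>R perp (hat p)) = 0" if "t \<in> {0..T}" for t x p
      by (rule tr'[OF that])
    show "norm (E' (t, x)) + \<bar>B' (t, x)\<bar> \<le> M" if "t \<in> {0..T}" "norm x \<le> R" for t x
      by (rule force(2)[OF that])
    show "f' (0, x, p) = 0" if "P \<le> norm p" for x p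
      using f0[OF that] by (simp add: init)
    show "cone_weight R 1 0 (t, x) \<noteq> 0" using x by (simp add: w_def)
    show "P + M * T + 2 \<le> norm p" using p by (simp add: A_def)
  qed

  obtain a :: "real^2" where a: "cball 0 R \<subseteq> cbox (- a) a"
    using bounded_subset_cbox_symmetric[OF bounded_cball] by blast
  \<comment> \<open>The radius |A| + 1 is positive even if A is not. Boxes with nonempty interior
    are needed at the end to pass from zero integrals to zero integrands.\<close>
  obtain c :: "real^2" where c: "cball 0 (\<bar>A\<bar> + 1) \<subseteq> cbox (- c) c"
    using bounded_subset_cbox_symmetric[OF bounded_cball] by blast
  have nonempty: "box (- a) a \<noteq> {}" "box (- c) c \<noteq> {}"
    using interior_mono[OF a] interior_mono[OF c] \<open>0 < R\<close> by (auto simp: interior_cbox)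
  let ?X = "cbox (- a) a" and ?P = "cbox (- c) c" and ?Q = "cbox (- a, - c) (a, c)"
  have Q: "?Q = ?X \<times> ?P" by (rule cbox_Pair_eq)
  have out_X: "w (t, x) = 0" if "t \<in> {0..T}" "x \<notin> ?X" for t x
  proof (rule ccontr)
    assume "w (t, x) \<noteq> 0"
    then have "x \<in> cball 0 R" using w_supp[OF that(1)] by simp
    then show False using a that(2) by blast
  qed
  have out_P: "f (t, x, p) = 0" "f' (t, x, p) = 0" if "t \<in> {0..T}" "w (t, x) \<noteq> 0" "p \<notin> ?P" for t x p
  proof -
    have "p \<notin> cball 0 (\<bar>A\<bar> + 1)" using c that(3) by blast
    then have "A \<le> norm p" by simp
    then show "f (t, x, p) = 0" "f' (t, x, p) = 0" using f_supp f'_supp that by auto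
  qed

  define V where "V = measure lborel ?P"
  have "0 \<le> V" by (simp add: V_def)
  \<comment> \<open>The difference of the forces will act on the momentum gradient of f', which
    therefore has to be bounded on the phase space box.\<close>
  have "\<exists>N\<ge>0. \<forall>z\<in>{0..T} \<times> ?Q. norm (Df' z (0, 0, axis i 1)) \<le> N" for i
  proof -
    have "continuous_on ({0..T} \<times> ?Q) (\<lambda>z. Df' z (0, 0, axis i 1))"
      by (rule continuous_on_subset[OF C1_derivD(2)[OF f']]) auto
    then show ?thesis
      by (rule continuous_on_compact_norm_bound[OF compact_Times[OF compact_Icc compact_cbox]])
  qed
  then obtain n where n: "\<And>i. 0 \<le> n i" "\<And>i z. z \<in> {0..T} \<times> ?Q \<Longrightarrow> norm (Df' z (0, 0, axis i 1)) \<le> n i"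
    by metis
  define N where "N = n 1 + n 2"
  have "0 \<le> N" using n(1) by (simp add: N_def)
  have Df'_bound: "\<bar>Df' (t, z) (0, 0, k)\<bar> \<le> N * norm k" if "t \<in> {0..T}" "z \<in> ?Q" for t z k
  proof -
    have L: "bounded_linear (Df' (t, z))"
      using has_derivative_bounded_linear[OF C1_derivD(1)[OF f']] that(1) by auto
    have "linear (\<lambda>h. Df' (t, z) (0, 0, h))"
      by (intro bounded_linear.linear bounded_linear_compose[OF L] bounded_linear_Pair
        bounded_linear_zero bounded_linear_ident)
    from linear_real2_expansion[OF this, of k]
    have "\<bar>Df' (t, z) (0, 0, k)\<bar> \<le> \<bar>k $ 1\<bar> * \<bar>Df' (t, z) (0, 0, axis 1 1)\<bar> + \<bar>k $ 2\<bar> * \<bar>Df' (t, z) (0, 0, axis 2 1)\<bar>"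
      unfolding sum_2 by (metis abs_mult abs_triangle_ineq real_scaleR_def)
    also have "\<dots> \<le> norm k * n 1 + norm k * n 2"
      using n(2)[of "(t, z)" 1] n(2)[of "(t, z)" 2] that component_le_norm_cart[of k]
      by (intro add_mono mult_mono) auto
    finally show ?thesis by (simp add: N_def algebra_simps)
  qed

  \<comment> \<open>Differences of the two solutions and their weighted energies\<close>
  define D where "D = (\<lambda>z. E z - E' z)"
  define b where "b = (\<lambda>z. B z - B' z)"
  define g where "g = (\<lambda>z. f z - f' z)"
  define e where "e = (\<lambda>z. D z \<bullet> D z + b z * b z)"
  have D: "C1_deriv ({0..T} \<times> UNIV) D (\<lambda>z h. DE z h - DE' z h)"
    unfolding D_def by (rule C1_deriv_diff[OF E E'])
  have b: "C1_deriv ({0..T} \<times> UNIV) b (\<lambda>z h. DB z h - DB' z h)"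
    unfolding b_def by (rule C1_deriv_diff[OF B B'])
  have g: "C1_deriv ({0..T} \<times> UNIV) g (\<lambda>z h. Df z h - Df' z h)"
    unfolding g_def by (rule C1_deriv_diff[OF f f'])
  have e_nonneg: "0 \<le> e z" for z by (simp add: e_def)
  have e_cont: "continuous_on ({0..T} \<times> UNIV) e"
    unfolding e_def by (intro continuous_intros C1_derivD(3)[OF D] C1_derivD(3)[OF b])
  have we_cont: "continuous_on S (\<lambda>x. w (t, h x) * e (t, h x))"
    if "t \<in> {0..T}" "continuous_on S h" for t S and h :: "'z::topological_space \<Rightarrow> real^2"
    using that
    by (intro continuous_on_mult continuous_on_compose2[OF w_cont[of UNIV]] continuous_on_compose2[OF e_cont]
      continuous_on_Pair continuous_on_const) auto
  have wg_cont: "continuous_on S (\<lambda>z. w (t, fst z) * (g (t, z) * g (t, z)))" if "t \<in> {0..T}" for t S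
    using that
    by (intro continuous_on_mult continuous_on_compose2[OF w_cont[of UNIV]]
      continuous_on_compose2[OF C1_derivD(3)[OF g]]
      continuous_on_Pair continuous_on_const continuous_on_fst continuous_on_id) auto

  define Y1 where "Y1 = (\<lambda>s. integral ?X (\<lambda>x. w (s, x) * e (s, x)))"
  define Y2 where "Y2 = (\<lambda>s. integral ?Q (\<lambda>z. w (s, fst z) * (g (s, z) * g (s, z))))"
  have Y1_nonneg: "0 \<le> Y1 t" if "t \<in> {0..T}" for t
    unfolding Y1_def using that
    by (intro integral_nonneg integrable_continuous we_cont mult_nonneg_nonneg w_nonneg e_nonneg continuous_on_id)
  have Y2_nonneg: "0 \<le> Y2 t" if "t \<in> {0..T}" for t
    unfolding Y2_def using that
    by (intro integral_nonneg integrable_continuous wg_cont mult_nonneg_nonneg w_nonneg zero_le_square)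

  \<comment> \<open>The current of g contributes Y2, and the term |D|^2 from Young's inequality,
    integrated over the momentum box, contributes V Y1.\<close>
  have Y1': "\<exists>I. (Y1 has_vector_derivative I) (at t within {0..T}) \<and> I \<le> 4 * pi * (Y2 t + V * Y1 t)"
    if t: "t \<in> {0..T}" for t
  proof -
    define J where "J = (\<lambda>x. current_density (\<lambda>z. f (t, z)) x - current_density (\<lambda>z. f' (t, z)) x)"
    define G where "G = (\<lambda>x. 4 * pi * (integral ?P (\<lambda>p. w (t, x) * (g (t, x, p) * g (t, x, p))) + V * (w (t, x) * e (t, x))))"
    have slice: "continuous_on ?P (\<lambda>p. f (t, x, p))" "continuous_on ?P (\<lambda>p. f' (t, x, p))" for x
      using t
      by (intro continuous_on_compose2[OF C1_derivD(3)[OF f]] continuous_on_compose2[OF C1_derivD(3)[OF f']]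
        continuous_on_Pair continuous_on_const continuous_on_id; auto)+
    \<comment> \<open>The momentum support is only known where w is nonzero; elsewhere both sides
      are 0.\<close>
    have bnd: "- 2 * w (t, x) * (D (t, x) \<bullet> J x) \<le> G x" for x
    proof (cases "w (t, x) = 0")
      case True
      then show ?thesis by (simp add: G_def)
    next
      case False
      have "w (t, x) * (- 2 * (D (t, x) \<bullet> J x)) \<le> w (t, x) * (4 * pi * (integral ?P (\<lambda>p. g (t, x, p) * g (t, x, p)) + V * (D (t, x) \<bullet> D (t, x))))"
        unfolding J_def g_def V_def
        by (intro mult_left_mono w_nonneg current_density_energy_bound slice out_P[OF t False])
      also have "\<dots> \<le> w (t, x) * (4 * pi * (integral ?P (\<lambda>p. g (t, x, p) * g (t, x, p)) + V * e (t, x)))"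
        using \<open>0 \<le> V\<close> by (intro mult_left_mono add_left_mono w_nonneg) (auto simp: e_def)
      also have "\<dots> = G x" by (simp add: G_def algebra_simps)
      finally show ?thesis by (simp add: mult_ac)
    qed
    have cont_int: "continuous_on ?X (\<lambda>x. integral ?P (\<lambda>p. w (t, x) * (g (t, x, p) * g (t, x, p))))"
      by (rule integral_continuous_on_param) (use wg_cont[OF t, of "?X \<times> ?P"] in \<open>simp add: case_prod_unfold\<close>)
    have cont_we: "continuous_on ?X (\<lambda>x. w (t, x) * e (t, x))"
      by (rule we_cont[OF t continuous_on_id])
    have G_cont: "continuous_on ?X G"
      unfolding G_def
      by (intro continuous_on_mult continuous_on_add continuous_on_const cont_int cont_we)
    have "integral ?X G = 4 * pi * (Y2 t + V * Y1 t)"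
    proof -
      have "Y2 t = integral ?X (\<lambda>x. integral ?P (\<lambda>p. w (t, x) * (g (t, x, p) * g (t, x, p))))"
        unfolding Y2_def by (subst integral_prod_continuous[OF wg_cont[OF t]]) simp
      moreover have "integral ?X G = 4 * pi * (integral ?X (\<lambda>x. integral ?P (\<lambda>p. w (t, x) * (g (t, x, p) * g (t, x, p)))) + V * Y1 t)"
        unfolding G_def Y1_def by (rule integral_cbox_lincomb[OF cont_int cont_we])
      ultimately show ?thesis by simp
    qed
    moreover obtain I where "(Y1 has_vector_derivative I) (at t within {0..T})" "I \<le> integral ?X G"
      unfolding Y1_def e_def
    proof (rule maxwell_energy[OF D b _ _ _ w_def out_X t bnd G_cont])
      fix x
      note m = maxwell_eqs_imp_derivs[OF E B T maxwell(1) t, of x]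
      note m' = maxwell_eqs_imp_derivs[OF E' B' T maxwell(2) t, of x]
      show "(DE (t, x) (1, 0) - DE' (t, x) (1, 0)) $ 1 - (DB (t, x) (0, axis 2 1) - DB' (t, x) (0, axis 2 1)) = - J x $ 1"
        using m(1) m'(1) by (simp add: J_def)
      show "(DE (t, x) (1, 0) - DE' (t, x) (1, 0)) $ 2 + (DB (t, x) (0, axis 1 1) - DB' (t, x) (0, axis 1 1)) = - J x $ 2"
        using m(2) m'(2) by (simp add: J_def)
      show "DB (t, x) (1, 0) - DB' (t, x) (1, 0) + (DE (t, x) (0, axis 1 1) - DE' (t, x) (0, axis 1 1)) $ 2 -
          (DE (t, x) (0, axis 2 1) - DE' (t, x) (0, axis 2 1)) $ 1 = 0"
        using m(3) m'(3) by simp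
    qed
    ultimately show ?thesis by auto
  qed

  have Y2': "\<exists>I. (Y2 has_vector_derivative I) (at t within {0..T}) \<and> I \<le> N * (Y2 t + 2 * (V * Y1 t))"
    if t: "t \<in> {0..T}" for t
  proof -
    \<comment> \<open>In the difference of the transport equations the force of the first solution
      acts on g. What remains is the difference of the forces acting on the momentum gradient of
      f'.\<close>
    define s where "s = (\<lambda>(x, p). - Df' (t, x, p) (0, 0, D (t, x) - b (t, x) *\<^sub>R perp (hat p)))"
    define G where "G = (\<lambda>z. N * (w (t, fst z) * (g (t, z) * g (t, z)) + 2 * (w (t, fst z) * e (t, fst z))))"
    have src: "Df (t, x, p) (1, hat p, E (t, x) - B (t, x) *\<^sub>R perp (hat p)) -
        Df' (t, x, p) (1, hat p, E (t, x) - B (t, x) *\<^sub>R perp (hat p)) = s (x, p)" for x p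
    proof -
      have "linear (Df' (t, x, p))"
        using has_derivative_linear[OF C1_derivD(1)[OF f']] t by auto
      from linear_add[OF this, of "(1, hat p, E' (t, x) - B' (t, x) *\<^sub>R perp (hat p))" "(0, 0, D (t, x) - b (t, x) *\<^sub>R perp (hat p))"]
      show ?thesis
        using tr[OF t, of x p] tr'[OF t, of x p] by (simp add: s_def D_def b_def algebra_simps)
    qed
    have bnd: "2 * w (t, x) * (g (t, x, p) * s (x, p)) \<le> G (x, p)" if z: "(x, p) \<in> ?Q" for x p
    proof -
      let ?d = "norm (D (t, x))" and ?\<beta> = "\<bar>b (t, x)\<bar>" and ?g = "\<bar>g (t, x, p)\<bar>"
      have "norm (D (t, x) - b (t, x) *\<^sub>R perp (hat p)) \<le> ?d + ?\<beta> * norm (hat p)"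
        by (rule order_trans[OF norm_triangle_ineq4]) simp
      also have "\<dots> \<le> ?d + ?\<beta>"
        using norm_hat_le[of p] by (simp add: mult_left_le)
      finally have k: "norm (D (t, x) - b (t, x) *\<^sub>R perp (hat p)) \<le> ?d + ?\<beta>" .
      have "\<bar>s (x, p)\<bar> \<le> N * norm (D (t, x) - b (t, x) *\<^sub>R perp (hat p))"
        using Df'_bound[OF t z] by (simp add: s_def)
      also have "\<dots> \<le> N * (?d + ?\<beta>)" by (rule mult_left_mono[OF k \<open>0 \<le> N\<close>])
      finally have s: "\<bar>s (x, p)\<bar> \<le> N * (?d + ?\<beta>)" .
      have "2 * (g (t, x, p) * s (x, p)) \<le> 2 * (?g * \<bar>s (x, p)\<bar>)"
        by (simp flip: abs_mult)
      also have "\<dots> \<le> 2 * (?g * (N * (?d + ?\<beta>)))"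
        by (intro mult_left_mono s) auto
      also have "\<dots> = N * (2 * ?g * (?d + ?\<beta>))" by simp
      also have "\<dots> \<le> N * (?g\<^sup>2 + 2 * (?d\<^sup>2 + ?\<beta>\<^sup>2))"
      proof (rule mult_left_mono[OF _ \<open>0 \<le> N\<close>])
        \<comment> \<open>The squares give 2 g (d + \<beta>) \<le> g^2 + (d + \<beta>)^2 and (d +
          \<beta>)^2 \<le> 2 (d^2 + \<beta>^2).\<close>
        have "0 \<le> (?g - (?d + ?\<beta>))\<^sup>2" "0 \<le> (?d - ?\<beta>)\<^sup>2" by simp_all
        then show "2 * ?g * (?d + ?\<beta>) \<le> ?g\<^sup>2 + 2 * (?d\<^sup>2 + ?\<beta>\<^sup>2)"
          by (simp add: power2_eq_square algebra_simps)
      qed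
      also have "?g\<^sup>2 + 2 * (?d\<^sup>2 + ?\<beta>\<^sup>2) = g (t, x, p) * g (t, x, p) + 2 * e (t, x)"
        by (simp add: e_def dot_square_norm power2_eq_square)
      finally have "w (t, x) * (2 * (g (t, x, p) * s (x, p))) \<le> w (t, x) * (N * (g (t, x, p) * g (t, x, p) + 2 * e (t, x)))"
        by (intro mult_left_mono w_nonneg)
      then show ?thesis by (simp add: G_def algebra_simps)
    qed
    have we: "continuous_on ?Q (\<lambda>z. w (t, fst z) * e (t, fst z))"
      by (rule we_cont[OF t continuous_on_fst[OF continuous_on_id]])
    have G_cont: "continuous_on ?Q G"
      unfolding G_def by (intro continuous_on_mult continuous_on_add continuous_on_const wg_cont[OF t] we)
    \<comment> \<open>The field energy density does not depend on p, so the momentum integral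
      contributes the factor V.\<close>
    have "integral ?Q (\<lambda>z. w (t, fst z) * e (t, fst z)) = V * Y1 t"
      unfolding integral_prod_continuous[OF we] Y1_def V_def fst_conv
        integral_const real_scaleR_def
      by (rule integral_mult_right)
    then have "integral ?Q G = N * (Y2 t + 2 * (V * Y1 t))"
      unfolding G_def Y2_def integral_cbox_lincomb[OF wg_cont[OF t] we] by simp
    moreover obtain I where "(Y2 has_vector_derivative I) (at t within {0..T})" "I \<le> integral ?Q G"
      unfolding Y2_def
    proof (rule vlasov_energy[OF g E B src w_def _ t bnd G_cont])
      fix t x p assume t: "t \<in> {0..T}" and "(x, p) \<notin> ?Q"
      then have "x \<notin> ?X \<or> p \<notin> ?P" by simp
      then have "w (t, x) = 0 \<or> g (t, x, p) = 0"
        using out_X[OF t, of x] out_P[OF t, of x p] unfolding g_def by fastforce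
      then show "w (t, x) * (g (t, x, p) * g (t, x, p)) = 0" by auto
    qed
    ultimately show ?thesis by auto
  qed

  have Y: "Y1 t0 + Y2 t0 = 0"
  \<comment> \<open>C is the sum of all coefficients of Y1 and Y2 in the two estimates; the terms
    this adds are nonnegative.\<close>
  proof (rule gronwall_zero[where T = T and Y = "\<lambda>t. Y1 t + Y2 t" and C = "4 * pi + 4 * pi * V + N + 2 * N * V"])
    show "0 \<le> Y1 t + Y2 t" if "t \<in> {0..T}" for t
      using Y1_nonneg[OF that] Y2_nonneg[OF that] by simp
    have "g (0, z) = 0" for z by (cases z) (simp add: g_def init)
    then show "Y1 0 + Y2 0 = 0"
      by (simp add: Y1_def Y2_def e_def D_def b_def init)
    show "t0 \<in> {0..T}" by (rule t0)
    fix t assume t: "t \<in> {0..T}"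
    obtain I1 I2 where I: "(Y1 has_vector_derivative I1) (at t within {0..T})" "I1 \<le> 4 * pi * (Y2 t + V * Y1 t)"
      "(Y2 has_vector_derivative I2) (at t within {0..T})" "I2 \<le> N * (Y2 t + 2 * (V * Y1 t))"
      using Y1'[OF t] Y2'[OF t] by blast
    have "I1 + I2 \<le> 4 * pi * (Y2 t + V * Y1 t) + N * (Y2 t + 2 * (V * Y1 t))"
      using I by linarith
    also have "\<dots> \<le> \<dots> + (4 * pi * Y1 t + 4 * pi * V * Y2 t + N * Y1 t + 2 * N * V * Y2 t)"
      using Y1_nonneg[OF t] Y2_nonneg[OF t] \<open>0 \<le> V\<close> \<open>0 \<le> N\<close> by simp
    also have "\<dots> = (4 * pi + 4 * pi * V + N + 2 * N * V) * (Y1 t + Y2 t)"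
      by (simp add: algebra_simps)
    finally show "\<exists>d. ((\<lambda>t. Y1 t + Y2 t) has_vector_derivative d) (at t within {0..T}) \<and>
        d \<le> (4 * pi + 4 * pi * V + N + 2 * N * V) * (Y1 t + Y2 t)"
      using has_vector_derivative_add[OF I(1,3)] by blast
  qed
  then have "Y1 t0 = 0" "Y2 t0 = 0" using Y1_nonneg[OF t0] Y2_nonneg[OF t0] by linarith+
  \<comment> \<open>Both integrands are continuous and nonnegative on boxes with nonempty interior,
    so zero integrals make them vanish pointwise, and at (t0, x0) the weight can be divided
    out.\<close>
  have x0: "x0 \<in> ?X" using out_X[OF t0] w0 by blast
  have "w (t0, x0) * e (t0, x0) = 0"
    using integral_cbox_eq_0_iff[OF we_cont[OF t0 continuous_on_id] nonempty(1)] \<open>Y1 t0 = 0\<close> x0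
    by (simp add: Y1_def w_nonneg e_nonneg)
  then have "D (t0, x0) \<bullet> D (t0, x0) + b (t0, x0) * b (t0, x0) = 0" using w0 by (simp add: e_def)
  moreover have "0 \<le> D (t0, x0) \<bullet> D (t0, x0)" "0 \<le> b (t0, x0) * b (t0, x0)" by simp_all
  ultimately have "D (t0, x0) \<bullet> D (t0, x0) = 0" "b (t0, x0) * b (t0, x0) = 0" by linarith+
  then have "D (t0, x0) = 0" "b (t0, x0) = 0" by simp_all
  moreover have "g (t0, x0, p0) = 0"
  \<comment> \<open>Outside the momentum box both densities are already zero; inside, the vanishing
    of Y2 decides.\<close>
  proof (cases "p0 \<in> ?P")
    case True
    have "box (- a, - c) (a, c) \<noteq> {}" using nonempty
      by (simp add: interior_cbox[symmetric] cbox_Pair_eq interior_Times del: interior_cbox)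
    from integral_cbox_eq_0_iff[OF wg_cont[OF t0] this]
    have "\<forall>z\<in>?Q. w (t0, fst z) * (g (t0, z) * g (t0, z)) = 0"
      using \<open>Y2 t0 = 0\<close> by (simp add: Y2_def w_nonneg)
    then show ?thesis using x0 True w0 by force
  next
    case False
    then show ?thesis using out_P[OF t0 w0] by (simp add: g_def)
  qed
  ultimately show ?thesis by (simp add: D_def b_def g_def)
qed

theorem theorem13:
  fixes T L :: real
    and f0 :: "(real^2) \<times> (real^2) \<Rightarrow> real"
    and E0 :: "real^2 \<Rightarrow> real^2"
    and B0 :: "real^2 \<Rightarrow> real"
    and U :: "real \<Rightarrow> (real^2, real^2) Cb4"
  assumes "T > 0" and "L > 0"
    and "Cck 2 f0" and "\<And>z. f0 z \<ge> 0"
    and "Cbk_on 3 UNIV E0" and "Cbk_on 3 UNIV B0"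
    and "\<And>x. divergence E0 x = charge_density f0 x"
    and "U \<in> control_space T L"
  shows "(\<forall>f E B f' E' B'.
      classical_solution T U f0 E0 B0 f E B \<and> classical_solution T U f0 E0 B0 f' E' B' \<longrightarrow>
      same_on T f E B f' E' B') \<and>
    (\<forall>f E B. Cb2_solution T U f0 E0 B0 f E B \<longrightarrow>
      classical_solution T U f0 E0 B0 f E B \<and>
      (\<forall>f' E' B'. classical_solution T U f0 E0 B0 f' E' B' \<longrightarrow> same_on T f' E' B' f E B))"
proof -
  have "bounded (closure {z. f0 z \<noteq> 0})"
    using assms(3) by (simp add: Cck_def compact_imp_bounded)
  then have "bounded {z. f0 z \<noteq> 0}" by (rule bounded_subset[OF _ closure_subset])
  then obtain P where P: "\<And>z. f0 z \<noteq> 0 \<Longrightarrow> norm z \<le> P" unfolding bounded_iff by auto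
  \<comment> \<open>P bounds the norm of the pair (x, p) on the support, hence that of p. Adding 1
    makes the inequality strict, since \<open>f0\<close> may be nonzero where the norm equals
    P.\<close>
  have f0: "f0 (x, p) = 0" if "P + 1 \<le> norm p" for x p
    using P[of "(x, p)"] that norm_snd_le[of p x] by linarith
  have uniq: "same_on T f E B f' E' B'"
    if "classical_solution T U f0 E0 B0 f E B" "classical_solution T U f0 E0 B0 f' E' B'" for f E B f' E' B'
  proof -
    have C1: "Ck_on 1 ({0..T} \<times> UNIV) f" "Ck_on 1 ({0..T} \<times> UNIV) E" "Ck_on 1 ({0..T} \<times> UNIV) B"
        "Ck_on 1 ({0..T} \<times> UNIV) f'" "Ck_on 1 ({0..T} \<times> UNIV) E'" "Ck_on 1 ({0..T} \<times> UNIV) B'"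
      and sol: "CVM T U f0 E0 B0 f E B" "CVM T U f0 E0 B0 f' E' B'"
      using that Ck_on_2_imp_1 by (auto simp: classical_solution_def)
    show ?thesis
      unfolding same_on_def using CVM_unique_at[OF assms(1) C1 sol f0] by blast
  qed
  \<comment> \<open>Boundedness is dropped, and for the density one order of differentiability as
    well.\<close>
  have "classical_solution T U f0 E0 B0 f E B" if "Cb2_solution T U f0 E0 B0 f E B" for f E B
    using that Ck_on_2_imp_1 by (auto simp: classical_solution_def Cb2_solution_def Cbk_on_def)
  then show ?thesis using uniq by blast
qed

end
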